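(* Let $G$ be a finite abelian group, $\widehat G$ its character group, and $\mathsf{B}\in\mathbb{C}[G]^{(n+1)\times(n+1)}$ a roux matrix for $G$ with roux parameters $\{c_g\}_{g\in G}$. Consider the roux scheme with thin relations $T_g$ (adjacency matrix $\lceil g\mathsf{I}\rfloor$) and thick relations $S_g$ (adjacency matrix $\lceil g\mathsf{B}\rfloor$), $g\in G$. For $\alpha\in\widehat G$ and $\epsilon\in\{+,-\}$ put \[ \widehat c_\alpha=\sum_{h\in G}c_h\overline{\alpha(h)},\qquad \mu_\alpha^\epsilon=\frac{\widehat c_\alpha+\epsilon\sqrt{\widehat c_\alpha^{\,2}+4n}}{2n},\qquad \lambda_\alpha^\epsilon=\frac{n+1}{2+\widehat c_\alpha\mu_\alpha^\epsilon}. \] Then the primitive idempotents of the scheme can be indexed as $\mathsf{E}_\alpha^\epsilon$ ($\alpha\in\widehat G$, $\epsilon\in\{+,-\}$) so that the first eigenmatrix $\mathsf{P}$ and second eigenmatrix $\mathsf{Q}$ have entries \[ \mathsf{P}_{(\alpha,\epsilon),T_g}=\overline{\alpha(g)},\quad \mathsf{P}_{(\alpha,\epsilon),S_g}=n\mu_\alpha^\epsilon\,\overline{\alpha(g)},\quad \mathsf{Q}_{T_g,(\alpha,\epsilon)}=\lambda_\alpha^\epsilon\,\alpha(g),\quad \mathsf{Q}_{S_g,(\alpha,\epsilon)}=\lambda_\alpha^\epsilon\mu_\alpha^\epsilon\,\alpha(g) \] for all $g\in G$, $\alpha\in\widehat G$, $\epsilon\in\{+,-\}$.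
   Context: A roux matrix for an abelian group $G$ is an $N\times N$ matrix $\mathsf{B}$ over the group algebra $\mathbb{C}[G]$ with $\mathsf{B}_{ii}=0$, $\mathsf{B}_{ij}\in G$ and $\mathsf{B}_{ji}=\mathsf{B}_{ij}^{-1}$ for $i\ne j$, and such that $\{g\mathsf{I}\}_{g\in G}\cup\{g\mathsf{B}\}_{g\in G}$ span an algebra; its roux parameters are the numbers $c_g$ with $\mathsf{B}^2=(N-1)\mathsf{I}+\sum_g c_g\,g\mathsf{B}$. The map $\lceil\cdot\rfloor:\mathbb{C}[G]^{N\times N}\to\mathbb{C}^{|G|N\times|G|N}$ replaces each entry by its image under the regular permutation representation of $G$; the matrices $\lceil g\mathsf{I}\rfloor,\lceil g\mathsf{B}\rfloor$ ($g\in G$) are the adjacency matrices of a commutative association scheme, called a roux scheme. For a scheme with adjacency matrices $\mathsf{A}_j$ and primitive idempotents $\mathsf{E}_i$, the first eigenmatrix is given by $\mathsf{A}_j=\sum_i\mathsf{P}_{ij}\mathsf{E}_i$ (rows indexed by idempotents, columns by relations) and the second eigenmatrix by $\mathsf{Q}=|\text{vertex set}|\cdot\mathsf{P}^{-1}$ (rows indexed by relations, columns by idempotents). *)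

theory Defs
  imports "HOL-Analysis.Analysis" "HOL-Library.Poly_Mapping"
begin

section \<open>Commutative association schemes and their eigenmatrices\<close>

definition mat_smult :: "'a::times \<Rightarrow> 'a ^ 'n ^ 'm \<Rightarrow> 'a ^ 'n ^ 'm"
  where "mat_smult a M = (\<chi> i j. a * M $ i $ j)"

lemma module_mat_smult: "module (mat_smult :: 'a::comm_ring_1 \<Rightarrow> 'a ^ 'n ^ 'm \<Rightarrow> 'a ^ 'n ^ 'm)"
  by unfold_locales (simp_all add: mat_smult_def vec_eq_iff algebra_simps)

definition adjacency_algebra :: "('r \<Rightarrow> complex ^ 'v ^ 'v) \<Rightarrow> (complex ^ 'v ^ 'v) set"
  where "adjacency_algebra A = module.span mat_smult (range A)"

definition commutative_scheme :: "('r::finite \<Rightarrow> complex ^ 'v ^ 'v) \<Rightarrow> bool"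
  where "commutative_scheme A \<longleftrightarrow>
    (\<forall>r x y. A r $ x $ y \<in> {0, 1}) \<and> (\<forall>r. A r \<noteq> 0) \<and>
    (\<exists>r. A r = mat 1) \<and> (\<Sum>r\<in>UNIV. A r) = (\<chi> x y. 1) \<and>
    (\<forall>r. \<exists>s. transpose (A r) = A s) \<and>
    (\<forall>r s. A r ** A s \<in> adjacency_algebra A) \<and> (\<forall>r s. A r ** A s = A s ** A r)"

text \<open>The primitive idempotents of a scheme are those of its adjacency algebra: the nonzero
  idempotents that are not sums of two nonzero orthogonal idempotents of the algebra.\<close>

definition primitive_idempotents :: "('r \<Rightarrow> complex ^ 'v ^ 'v) \<Rightarrow> (complex ^ 'v ^ 'v) set"
  where "primitive_idempotents A = {E \<in> adjacency_algebra A. E \<noteq> 0 \<and> E ** E = E \<and>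
    (\<forall>F \<in> adjacency_algebra A. \<forall>F' \<in> adjacency_algebra A.
       E = F + F' \<and> F ** F = F \<and> F' ** F' = F' \<and> F ** F' = 0 \<and> F' ** F = 0
         \<longrightarrow> F = 0 \<or> F' = 0)}"

text \<open>Idempotents are indexed by a finite set \<open>I\<close> and relations by the type \<open>'r\<close>. An eigenmatrix is
  a function of its row and its column index: \<open>P\<close> takes an idempotent and then a relation, \<open>Q\<close> a
  relation and then an idempotent. Values at indices outside \<open>I\<close> are irrelevant.\<close>

definition first_eigenmatrix ::
  "('r \<Rightarrow> complex ^ 'v ^ 'v) \<Rightarrow> 'i set \<Rightarrow> ('i \<Rightarrow> complex ^ 'v ^ 'v) \<Rightarrow> ('i \<Rightarrow> 'r \<Rightarrow> complex) \<Rightarrow> bool"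
  where "first_eigenmatrix A I E P \<longleftrightarrow> (\<forall>r. A r = (\<Sum>i\<in>I. mat_smult (P i r) (E i)))"

text \<open>\<open>Q = d P\<^sup>-\<^sup>1\<close>, where \<open>d \<noteq> 0\<close> is the number of vertices. As the two index sets of \<open>P\<close> differ, this
  is spelled out as \<open>P Q = d I\<close> and \<open>Q P = d I\<close>.\<close>

definition second_eigenmatrix ::
  "nat \<Rightarrow> 'i set \<Rightarrow> ('i \<Rightarrow> 'r::finite \<Rightarrow> complex) \<Rightarrow> ('r \<Rightarrow> 'i \<Rightarrow> complex) \<Rightarrow> bool"
  where "second_eigenmatrix d I P Q \<longleftrightarrow>
    (\<forall>i\<in>I. \<forall>i'\<in>I. (\<Sum>r\<in>UNIV. P i r * Q r i') = (if i = i' then of_nat d else 0)) \<and>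
    (\<forall>r s. (\<Sum>i\<in>I. Q r i * P i s) = (if r = s then of_nat d else 0))"


section \<open>Roux matrices\<close>

text \<open>A finite abelian group \<open>G\<close> is a type \<open>'g\<close> of class \<open>{finite, ab_group_add}\<close>, hence written
  additively. Its group algebra is \<open>'g \<Rightarrow>\<^sub>0 complex\<close>: multiplication is convolution, and the group
  element \<open>g\<close> is \<open>single g 1\<close>, so that \<open>single (- g) 1\<close> is its inverse. Complex scalars embed as
  \<open>single 0 a\<close>.\<close>

abbreviation group_elem :: "'g \<Rightarrow> ('g \<Rightarrow>\<^sub>0 complex)"
  where "group_elem g \<equiv> Poly_Mapping.single g 1"

definition roux_span ::
  "('g::{finite, ab_group_add} \<Rightarrow>\<^sub>0 complex) ^ 'n ^ 'n \<Rightarrow> (('g \<Rightarrow>\<^sub>0 complex) ^ 'n ^ 'n) set"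
  where "roux_span B = module.span (\<lambda>a. mat_smult (Poly_Mapping.single 0 a))
    (range (\<lambda>g. mat_smult (group_elem g) (mat 1)) \<union> range (\<lambda>g. mat_smult (group_elem g) B))"

definition is_roux :: "('g::{finite, ab_group_add} \<Rightarrow>\<^sub>0 complex) ^ 'n ^ 'n \<Rightarrow> bool"
  where "is_roux B \<longleftrightarrow>
    (\<forall>i. B $ i $ i = 0) \<and>
    (\<forall>i j. i \<noteq> j \<longrightarrow> (\<exists>g. B $ i $ j = group_elem g \<and> B $ j $ i = group_elem (- g))) \<and>
    (\<forall>X \<in> roux_span B. \<forall>Y \<in> roux_span B. X ** Y \<in> roux_span B)"

definition roux_parameters ::
  "('g::{finite, ab_group_add} \<Rightarrow>\<^sub>0 complex) ^ 'n ^ 'n \<Rightarrow> ('g \<Rightarrow> complex) \<Rightarrow> bool"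
  where "roux_parameters B c \<longleftrightarrow>
    B ** B = mat (of_nat CARD('n) - 1) +
      (\<Sum>g\<in>UNIV. mat_smult (Poly_Mapping.single 0 (c g)) (mat_smult (group_elem g) B))"

text \<open>The linear extension of the regular representation, where \<open>g\<close> permutes the basis of
  \<open>\<complex>\<^sup>G\<close> by \<open>e\<^sub>k \<mapsto> e\<^bsub>g+k\<^esub>\<close>.\<close>

definition regular_rep ::
  "('g \<Rightarrow>\<^sub>0 complex) \<Rightarrow> complex ^ ('g::{finite, ab_group_add}) ^ ('g::{finite, ab_group_add})"
  where "regular_rep x = (\<chi> h k. \<Sum>g\<in>UNIV. Poly_Mapping.lookup x g * of_bool (h = g + k))"

definition block_rep ::
  "('g::{finite, ab_group_add} \<Rightarrow>\<^sub>0 complex) ^ 'n ^ 'n \<Rightarrow> complex ^ ('n \<times> 'g) ^ ('n \<times> 'g)"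
  where "block_rep M = (\<chi> p q. regular_rep (M $ fst p $ fst q) $ snd p $ snd q)"

datatype 'g roux_rel = Thin 'g | Thick 'g

lemma UNIV_roux_rel: "UNIV = range Thin \<union> range Thick"
  by (metis (full_types) UNIV_eq_I UnCI rangeI roux_rel.exhaust)

instance roux_rel :: (finite) finite
  by standard (simp add: UNIV_roux_rel)

fun roux_scheme ::
  "('g::{finite, ab_group_add} \<Rightarrow>\<^sub>0 complex) ^ 'n ^ 'n \<Rightarrow> 'g roux_rel \<Rightarrow> complex ^ ('n \<times> 'g) ^ ('n \<times> 'g)"
  where
    "roux_scheme B (Thin g) = block_rep (mat_smult (group_elem g) (mat 1))"
  | "roux_scheme B (Thick g) = block_rep (mat_smult (group_elem g) B)"


section \<open>Characters and the eigenvalue data\<close>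

definition characters :: "('g::ab_group_add \<Rightarrow> complex) set"
  where "characters = {\<alpha>. \<alpha> 0 = 1 \<and> (\<forall>g h. \<alpha> (g + h) = \<alpha> g * \<alpha> h)}"

datatype sign = Plus | Minus

fun sign_val :: "sign \<Rightarrow> complex"
  where "sign_val Plus = 1" | "sign_val Minus = - 1"

definition roux_hat :: "('g::{finite, ab_group_add} \<Rightarrow> complex) \<Rightarrow> ('g \<Rightarrow> complex) \<Rightarrow> complex"
  where "roux_hat c \<alpha> = (\<Sum>h\<in>UNIV. c h * cnj (\<alpha> h))"

text \<open>Roux parameters of a roux matrix of size at least 2 are nonnegative integers with \<open>c (- g) = c g\<close>, so \<open>roux_hat c \<alpha>\<close> is real and the
  principal root \<open>csqrt\<close> below is the usual square root of a positive real.\<close>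

definition roux_mu ::
  "nat \<Rightarrow> ('g::{finite, ab_group_add} \<Rightarrow> complex) \<Rightarrow> ('g \<Rightarrow> complex) \<Rightarrow> sign \<Rightarrow> complex"
  where "roux_mu n c \<alpha> \<epsilon> =
    (roux_hat c \<alpha> + sign_val \<epsilon> * csqrt ((roux_hat c \<alpha>)\<^sup>2 + 4 * of_nat n)) / (2 * of_nat n)"

definition roux_lambda ::
  "nat \<Rightarrow> ('g::{finite, ab_group_add} \<Rightarrow> complex) \<Rightarrow> ('g \<Rightarrow> complex) \<Rightarrow> sign \<Rightarrow> complex"
  where "roux_lambda n c \<alpha> \<epsilon> = (of_nat n + 1) / (2 + roux_hat c \<alpha> * roux_mu n c \<alpha> \<epsilon>)"


section \<open>Roux schemes are commutative association schemes\<close>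

lemma regular_rep_nth: "regular_rep x $ h $ k = Poly_Mapping.lookup x (h - k)"
proof -
  have "{g. h = g + k} = {h - k}"
    by (auto simp: algebra_simps)
  then show ?thesis
    by (simp add: regular_rep_def)
qed

lemma block_rep_nth:
  "block_rep M $ (i, h) $ (j, k) = Poly_Mapping.lookup (M $ i $ j) (h - k)"
  by (simp add: block_rep_def regular_rep_nth)

lemma lookup_times_finite:
  fixes x y :: "'g::{finite, ab_group_add} \<Rightarrow>\<^sub>0 complex"
  shows "Poly_Mapping.lookup (x * y) k =
    (\<Sum>l\<in>UNIV. Poly_Mapping.lookup x l * Poly_Mapping.lookup y (k - l))"
proof -
  have "(k = l + q) = (q = k - l)" for l q :: 'g
    by (auto simp: algebra_simps)
  then show ?thesis
    by (simp add: times_poly_mapping.rep_eq prod_fun_def Sum_any.expand_superset[of UNIV] when_def)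
qed

lemma block_rep_mult:
  fixes M N :: "('g::{finite, ab_group_add} \<Rightarrow>\<^sub>0 complex) ^ 'n ^ 'n"
  shows "block_rep M ** block_rep N = block_rep (M ** N)"
proof -
  have "(\<Sum>l\<in>UNIV. Poly_Mapping.lookup x (h - l) * Poly_Mapping.lookup y (l - k))
      = Poly_Mapping.lookup (x * y) (h - k)" for x y :: "'g \<Rightarrow>\<^sub>0 complex" and h k
    unfolding lookup_times_finite
    by (rule sum.reindex_bij_witness[of _ "\<lambda>l. h - l" "\<lambda>l. h - l"]) (auto simp: algebra_simps)
  moreover have "(\<Sum>p\<in>UNIV. f p) = (\<Sum>j\<in>UNIV. \<Sum>l\<in>UNIV. f (j, l))" for f :: "'n \<times> 'g \<Rightarrow> complex"
    by (simp add: sum.cartesian_product flip: UNIV_Times_UNIV)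
  ultimately show ?thesis
    by (simp add: vec_eq_iff block_rep_nth matrix_matrix_mult_def lookup_sum)
qed

lemma block_rep_smult:
  "block_rep (mat_smult (Poly_Mapping.single 0 a) M) = mat_smult a (block_rep M)"
  by (simp add: vec_eq_iff block_rep_nth mat_smult_def lookup_times_finite lookup_single when_def
      if_distrib[of "\<lambda>x. x * _"] cong: if_cong)

lemma block_rep_sum: "block_rep (\<Sum>x\<in>S. f x) = (\<Sum>x\<in>S. block_rep (f x))"
  by (simp add: vec_eq_iff block_rep_nth lookup_sum)

lemma module_group_algebra_mat:
  "module (\<lambda>a. mat_smult (Poly_Mapping.single 0 a) ::
     ('g::{finite, ab_group_add} \<Rightarrow>\<^sub>0 complex) ^ 'n ^ 'm \<Rightarrow> _)"
  by unfold_locales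
    (simp_all add: mat_smult_def vec_eq_iff algebra_simps single_add mult_single
      flip: mult.assoc)

lemma block_rep_roux_span:
  assumes "X \<in> roux_span B"
  shows "block_rep X \<in> adjacency_algebra (roux_scheme B)"
proof -
  interpret C: module "mat_smult :: complex \<Rightarrow> complex ^ ('b \<times> 'a) ^ ('b \<times> 'a) \<Rightarrow> _"
    by (rule module_mat_smult)
  let ?S = "range (\<lambda>g. mat_smult (group_elem g) (mat 1)) \<union> range (\<lambda>g. mat_smult (group_elem g) B)"
  obtain t r where t: "t \<subseteq> ?S"
    and X: "X = (\<Sum>a\<in>t. mat_smult (Poly_Mapping.single 0 (r a)) a)"
    using assms unfolding roux_span_def module.span_explicit[OF module_group_algebra_mat] by blast
  have "block_rep a \<in> range (roux_scheme B)" if "a \<in> ?S" for a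
    using that by (auto intro: range_eqI[of _ _ "Thin _"] range_eqI[of _ _ "Thick _"])
  with t show ?thesis
    unfolding X adjacency_algebra_def block_rep_sum block_rep_smult
    by (intro C.span_sum C.span_scale C.span_base) blast
qed

theorem commutative_scheme_roux_scheme:
  fixes B :: "('g::{finite, ab_group_add} \<Rightarrow>\<^sub>0 complex) ^ 'n ^ 'n"
  assumes B: "is_roux B" and N: "CARD('n) \<ge> 2"
  shows "commutative_scheme (roux_scheme B)"
proof -
  interpret M: module "\<lambda>a. mat_smult (Poly_Mapping.single 0 a) ::
     ('g \<Rightarrow>\<^sub>0 complex) ^ 'n ^ 'n \<Rightarrow> _"
    by (rule module_group_algebra_mat)
  have diag: "B $ i $ i = 0" for i
    using B by (simp add: is_roux_def)
  have "\<forall>i j. \<exists>g. i \<noteq> j \<longrightarrow> B $ i $ j = group_elem g \<and> B $ j $ i = group_elem (- g)"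
    using B by (auto simp: is_roux_def)
  then obtain b where b: "\<And>i j. i \<noteq> j \<Longrightarrow> B $ i $ j = group_elem (b i j)"
    and b': "\<And>i j. i \<noteq> j \<Longrightarrow> B $ j $ i = group_elem (- b i j)"
    by metis
  have thin: "roux_scheme B (Thin g) $ (i, h) $ (j, k) = of_bool (i = j \<and> g = h - k)" for g h k i j
    by (auto simp: block_rep_nth mat_smult_def mat_def lookup_single when_def)
  have thick: "roux_scheme B (Thick g) $ (i, h) $ (j, k)
      = of_bool (i \<noteq> j \<and> g = h - k - b i j)" for g h k i j
    by (cases "i = j")
      (auto simp: block_rep_nth mat_smult_def diag b mult_single lookup_single when_def algebra_simps)
  have thick': "roux_scheme B (Thick g) $ (j, k) $ (i, h)
      = of_bool (i \<noteq> j \<and> - g = h - k - b i j)" for g h k i j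
    by (cases "i = j")
      (auto simp: block_rep_nth mat_smult_def diag b' mult_single lookup_single when_def
        algebra_simps eq_neg_iff_add_eq_0 neg_eq_iff_add_eq_0)
  define gen where "gen = (\<lambda>r. case r of Thin g \<Rightarrow> mat_smult (group_elem g) (mat 1)
      | Thick g \<Rightarrow> mat_smult (group_elem g) B)"
  have gen: "roux_scheme B r = block_rep (gen r)" for r
    by (cases r) (simp_all add: gen_def)
  have gen_span: "gen r \<in> roux_span B" for r
    unfolding roux_span_def by (rule M.span_base) (cases r; simp add: gen_def)
  have smult_mult: "mat_smult x X ** mat_smult y Y = mat_smult (x * y) (X ** Y)"
    for x y and X Y :: "('g \<Rightarrow>\<^sub>0 complex) ^ 'n ^ 'n"
    by (simp add: mat_smult_def matrix_matrix_mult_def vec_eq_iff sum_distrib_left mult_ac)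
  have gen_comm: "gen r ** gen s = gen s ** gen r" for r s
    by (cases r; cases s) (simp_all add: gen_def smult_mult mult.commute)
  show ?thesis
    unfolding commutative_scheme_def
  proof (intro conjI allI)
    fix r and x y :: "'n \<times> 'g"
    show "roux_scheme B r $ x $ y \<in> {0, 1}"
      by (cases r; cases x; cases y) (simp_all only: thin thick of_bool_def, simp_all)
  next
    fix r
    obtain i j :: 'n where ij: "i \<noteq> j"
      using N card_le_Suc0_iff_eq[of "UNIV :: 'n set"] by fastforce
    have "\<exists>x y. roux_scheme B r $ x $ y \<noteq> 0"
    proof (cases r)
      case (Thin g)
      have "roux_scheme B r $ (i, g) $ (i, 0) \<noteq> 0"
        unfolding Thin thin by simp
      then show ?thesis by blast
    next
      case (Thick g)
      have "roux_scheme B r $ (i, g + b i j) $ (j, 0) \<noteq> 0"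
        unfolding Thick thick using ij by simp
      then show ?thesis by blast
    qed
    then show "roux_scheme B r \<noteq> 0"
      by fastforce
  next
    have "roux_scheme B (Thin 0) = mat 1"
      by (auto simp: vec_eq_iff thin mat_def simp del: roux_scheme.simps)
    then show "\<exists>r. roux_scheme B r = mat 1" by blast
  next
    have "(\<Sum>r\<in>UNIV. roux_scheme B r) = (\<Sum>g\<in>UNIV. roux_scheme B (Thin g)) + (\<Sum>g\<in>UNIV. roux_scheme B (Thick g))"
      unfolding UNIV_roux_rel
      by (subst sum.union_disjoint) (auto simp: sum.reindex inj_on_def)
    also have "\<dots> = (\<chi> x y. 1)"
    proof -
      have "(\<Sum>g\<in>UNIV. of_bool (p \<and> g = h)) = (of_bool p :: complex)" for p and h :: 'g
        by (cases p) simp_all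
      then show ?thesis
        by (simp add: vec_eq_iff thin thick del: roux_scheme.simps sum_of_bool_eq)
    qed
    finally show "(\<Sum>r\<in>UNIV. roux_scheme B r) = (\<chi> x y. 1)" .
  next
    fix r
    show "\<exists>s. transpose (roux_scheme B r) = roux_scheme B s"
    proof (cases r)
      case (Thin g)
      have "(g = k - h) = (- g = h - k)" for h k
        by (subst neg_equal_iff_equal[symmetric]) simp
      then have "roux_scheme B (Thin g) $ (j, k) $ (i, h) = roux_scheme B (Thin (- g)) $ (i, h) $ (j, k)"
        for h k i j
        unfolding thin by auto
      then have "transpose (roux_scheme B r) = roux_scheme B (Thin (- g))"
        unfolding Thin by (simp only: vec_eq_iff transpose_def vec_lambda_beta split_paired_All) blast
      then show ?thesis by blast
    next
      case (Thick g)
      have "roux_scheme B (Thick g) $ (j, k) $ (i, h) = roux_scheme B (Thick (- g)) $ (i, h) $ (j, k)"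
        for h k i j
        by (subst thick', subst thick) (rule refl)
      then have "transpose (roux_scheme B r) = roux_scheme B (Thick (- g))"
        unfolding Thick by (simp only: vec_eq_iff transpose_def vec_lambda_beta split_paired_All) blast
      then show ?thesis by blast
    qed
  next
    fix r s
    show "roux_scheme B r ** roux_scheme B s \<in> adjacency_algebra (roux_scheme B)"
      unfolding gen[of r] gen[of s] block_rep_mult
      using B gen_span by (intro block_rep_roux_span) (simp add: is_roux_def)
    show "roux_scheme B r ** roux_scheme B s = roux_scheme B s ** roux_scheme B r"
      unfolding gen block_rep_mult by (simp only: gen_comm)
  qed
qed

end

theory Submission
  imports Defs
begin

text \<open>
  For a character \<open>\<alpha>\<close> the vectors \<open>X = \<Sum>\<^sub>g \<alpha>(g) T\<^sub>g\<close> and \<open>Y = \<Sum>\<^sub>g \<alpha>(g) S\<^sub>g\<close> span a subspace of the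
  adjacency algebra that is stable under multiplication: \<open>T\<^sub>h\<close> acts on it as the scalar \<open>cnj (\<alpha> h)\<close>, and
  \<open>S\<^sub>0\<close> maps \<open>X\<close> to \<open>Y\<close> and \<open>Y\<close> to \<open>n X + c Y\<close>, where \<open>c = roux_hat c \<alpha>\<close>. The eigenvectors of \<open>S\<^sub>0\<close> are the
  \<open>X + \<mu> Y\<close> for the two roots \<open>\<mu>\<close> of \<open>n \<mu>\<^sup>2 = 1 + c \<mu>\<close>, with eigenvalue \<open>n \<mu>\<close>; scaled by \<open>\<lambda> / |vertex set|\<close> they
  are the primitive idempotents. Orthogonality of characters and the relations between the two roots
  show that \<open>P\<close> and \<open>Q\<close> are inverse to each other up to the number of vertices, which gives the
  idempotents, their orthogonality and the expansion of the adjacency matrices all at once. The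
  roux parameters are real and even, so \<open>c\<close> is real and \<open>\<lambda>\<close> has a nonzero denominator.
\<close>

section \<open>Characters of finite abelian groups\<close>

definition nmult :: "nat \<Rightarrow> 'g::ab_group_add \<Rightarrow> 'g"
  where "nmult m x = ((+) x ^^ m) 0"

lemma nmult_0 [simp]: "nmult 0 x = 0"
  and nmult_Suc [simp]: "nmult (Suc m) x = x + nmult m x"
  by (simp_all add: nmult_def)

lemma nmult_add: "nmult (m + k) x = nmult m x + nmult k x"
  by (induction m) (simp_all add: add_ac)

lemma nmult_nmult: "nmult m (nmult k x) = nmult (m * k) x"
  by (induction m) (simp_all add: nmult_add)

text \<open>A homomorphism on a subgroup: in a finite group, a subset that contains 0 and is closed
  under addition is a subgroup. Outside \<open>H\<close> the values of \<open>\<alpha>\<close> are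
  arbitrary.\<close>

definition partial_character :: "'g::ab_group_add set \<Rightarrow> ('g \<Rightarrow> complex) \<Rightarrow> bool"
  where "partial_character H \<alpha> \<longleftrightarrow> 0 \<in> H \<and> (\<forall>a\<in>H. \<forall>b\<in>H. a + b \<in> H) \<and>
    \<alpha> 0 = 1 \<and> (\<forall>a\<in>H. \<forall>b\<in>H. \<alpha> (a + b) = \<alpha> a * \<alpha> b)"

lemma partial_character_UNIV: "partial_character UNIV \<alpha> \<longleftrightarrow> \<alpha> \<in> characters"
  by (auto simp: partial_character_def characters_def)

text \<open>Translation by \<open>a\<close> is an injective self-map of the finite set
  \<open>H\<close>, hence onto, so it hits 0.\<close>

lemma partial_character_minus:
  fixes H :: "'g::{finite, ab_group_add} set"
  assumes "partial_character H \<alpha>" and "a \<in> H"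
  shows "- a \<in> H"
proof -
  have "(+) a ` H = H"
    using assms by (intro endo_inj_surj) (auto simp: partial_character_def)
  then obtain t where "t \<in> H" "0 = a + t"
    using assms by (metis (no_types, lifting) imageE partial_character_def)
  then show ?thesis
    by (simp add: eq_neg_iff_add_eq_0 minus_unique)
qed

lemma partial_character_nmult:
  assumes "partial_character H \<alpha>" and "a \<in> H"
  shows "nmult m a \<in> H \<and> \<alpha> (nmult m a) = \<alpha> a ^ m"
  using assms by (induction m) (auto simp: partial_character_def)

lemma nmult_eq_0_ex: "\<exists>k>0. nmult k (x::'g::{finite, ab_group_add}) = 0"
proof -
  have "\<not> inj (\<lambda>m. nmult m x)"
    using finite_imageD[of "\<lambda>m. nmult m x" UNIV] by (auto intro: finite_subset)
  then obtain m m' where "nmult m x = nmult m' x" "m < m'"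
    by (metis injI linorder_neqE_nat)
  then have "nmult (m' - m) x = 0"
    using nmult_add[of m "m' - m" x] by simp
  with \<open>m < m'\<close> show ?thesis
    by (intro exI[of _ "m' - m"]) simp
qed

text \<open>The value \<open>z\<close> may be any root: for \<open>H = {0}\<close> it can be chosen different from \<open>1\<close>, which is how
  characters are seen to separate points.\<close>

lemma partial_character_extend_one:
  fixes H :: "'g::{finite, ab_group_add} set"
  assumes H: "partial_character H \<alpha>" and k: "k > 0" "nmult k x \<in> H"
    and least: "\<And>m. 0 < m \<Longrightarrow> m < k \<Longrightarrow> nmult m x \<notin> H"
    and z: "z ^ k = \<alpha> (nmult k x)"
  shows "\<exists>K \<beta>. partial_character K \<beta> \<and> H \<subseteq> K \<and> (\<forall>h\<in>H. \<beta> h = \<alpha> h) \<and> x \<in> K \<and> \<beta> x = z"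
proof -
  \<comment> \<open>Sending \<open>x\<close> to \<open>z\<close> agrees with \<open>\<alpha>\<close>
    on the multiples of \<open>x\<close> that already lie in \<open>H\<close>: by minimality of
    \<open>k\<close> such an \<open>m\<close> is a multiple of \<open>k\<close>, and there the
    equation for \<open>z\<close> decides.\<close>
  have z_mult: "\<alpha> (nmult m x) = z ^ m" if m: "nmult m x \<in> H" for m
  proof -
    define q where "q = m div k"
    have q: "nmult (q * k) x \<in> H" "\<alpha> (nmult (q * k) x) = z ^ (q * k)"
      using partial_character_nmult[OF H k(2), of q]
      by (simp_all add: nmult_nmult z[symmetric] power_mult[symmetric] mult.commute)
    have "nmult m x = nmult (m mod k) x + nmult (q * k) x"
      by (simp add: q_def flip: nmult_add)
    then have "nmult (m mod k) x = nmult m x + - nmult (q * k) x"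
      by (simp add: algebra_simps)
    then have "nmult (m mod k) x \<in> H"
      using H m partial_character_minus[OF H q(1)] by (auto simp: partial_character_def)
    then have "k dvd m"
      using least[of "m mod k"] k(1) by (metis gr0I mod_eq_0_iff_dvd mod_less_divisor)
    then have "q * k = m"
      by (simp add: q_def)
    with q show ?thesis
      by simp
  qed
  define K where "K = {h + nmult m x | h m. h \<in> H}"
  \<comment> \<open>Independence of the representation of an element of \<open>K\<close>.
    Subtraction of naturals asks for \<open>m \<le> m'\<close>; the other case follows below by
    symmetry.\<close>
  have wd: "\<alpha> h * z ^ m = \<alpha> h' * z ^ m'"
    if "h \<in> H" "h' \<in> H" "h + nmult m x = h' + nmult m' x" "m \<le> m'" for h h' m m'
  proof -
    have "nmult m' x = nmult (m' - m) x + nmult m x"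
      using that(4) by (simp flip: nmult_add)
    then have eq: "h = h' + nmult (m' - m) x"
      using that(3) by (simp add: add_ac)
    then have "nmult (m' - m) x = h + - h'"
      by simp
    then have d: "nmult (m' - m) x \<in> H"
      using H that partial_character_minus[OF H that(2)] by (auto simp: partial_character_def)
    have "\<alpha> h = \<alpha> h' * z ^ (m' - m)"
      using eq H d that(2) z_mult[OF d] by (simp add: partial_character_def)
    then show ?thesis
      using that(4) by (simp flip: power_add)
  qed
  \<comment> \<open>By \<open>wd\<close> the chosen value is unique for \<open>y \<in> K\<close>;
    off \<open>K\<close> it is arbitrary.\<close>
  define \<beta> where "\<beta> y = (SOME v. \<exists>h m. h \<in> H \<and> y = h + nmult m x \<and> v = \<alpha> h * z ^ m)" for y
  have \<beta>: "\<beta> (h + nmult m x) = \<alpha> h * z ^ m" if "h \<in> H" for h m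
    unfolding \<beta>_def
  proof (rule some_equality)
    fix v
    assume "\<exists>h' m'. h' \<in> H \<and> h + nmult m x = h' + nmult m' x \<and> v = \<alpha> h' * z ^ m'"
    then obtain h' m' where "h' \<in> H" "h + nmult m x = h' + nmult m' x" "v = \<alpha> h' * z ^ m'"
      by blast
    then show "v = \<alpha> h * z ^ m"
      using wd[of h h' m m'] wd[of h' h m' m] that by (cases "m \<le> m'") auto
  qed (use that in blast)
  have 0: "0 \<in> H" "\<alpha> 0 = 1"
    using H by (auto simp: partial_character_def)
  have sum: "(h + nmult m x) + (h' + nmult m' x) = (h + h') + nmult (m + m') x" for h h' m m'
    by (simp add: nmult_add add_ac)
  have "h + nmult 0 x \<in> K" if "h \<in> H" for h
    using that unfolding K_def by blast
  then have "H \<subseteq> K"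
    by auto
  moreover have "\<forall>h\<in>H. \<beta> h = \<alpha> h"
    using \<beta>[of _ 0] by simp
  moreover have "0 + nmult 1 x \<in> K"
    using 0 unfolding K_def by blast
  moreover have "\<beta> x = z"
    using \<beta>[OF 0(1), of 1] 0 by simp
  moreover have "partial_character K \<beta>"
    unfolding partial_character_def
  proof (intro conjI ballI)
    show "0 \<in> K"
      using \<open>H \<subseteq> K\<close> 0 by blast
    show "\<beta> 0 = 1"
      using \<beta>[OF 0(1), of 0] 0 by simp
    fix a b
    assume "a \<in> K" "b \<in> K"
    then obtain h m h' m' where ab: "a = h + nmult m x" "b = h' + nmult m' x" "h \<in> H" "h' \<in> H"
      unfolding K_def by blast
    then have hh: "h + h' \<in> H" "\<alpha> (h + h') = \<alpha> h * \<alpha> h'"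
      using H by (auto simp: partial_character_def)
    show "a + b \<in> K"
      unfolding ab sum K_def using hh by blast
    show "\<beta> (a + b) = \<beta> a * \<beta> b"
      unfolding ab sum \<beta>[OF hh(1)] \<beta>[OF ab(3)] \<beta>[OF ab(4)] hh(2) by (simp add: power_add)
  qed
  ultimately show ?thesis
    by auto
qed

section \<open>Values and finiteness of characters\<close>

lemma character_root_of_unity:
  fixes \<alpha> :: "'g::{finite, ab_group_add} \<Rightarrow> complex"
  assumes "\<alpha> \<in> characters"
  shows "\<alpha> g ^ CARD('g) = 1"
proof -
  have \<alpha>: "\<alpha> 0 = 1" "\<alpha> (a + b) = \<alpha> a * \<alpha> b" for a b
    using assms by (auto simp: characters_def)
  have "\<alpha> h \<noteq> 0" for h
    using \<alpha>(2)[of h "- h"] \<alpha>(1) by auto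
  then have nz: "(\<Prod>h\<in>UNIV. \<alpha> h) \<noteq> 0"
    by simp
  \<comment> \<open>Translation by \<open>g\<close> permutes the group, so the product of all values
    is unchanged, yet it gains the factor \<open>\<alpha> g ^ CARD('g)\<close>.\<close>
  have "(\<Prod>h\<in>UNIV. \<alpha> h) = (\<Prod>h\<in>UNIV. \<alpha> (g + h))"
    by (rule prod.reindex_bij_witness[of _ "\<lambda>h. g + h" "\<lambda>h. h - g"]) auto
  also have "\<dots> = \<alpha> g ^ CARD('g) * (\<Prod>h\<in>UNIV. \<alpha> h)"
    by (simp add: \<alpha>(2) prod.distrib)
  finally show ?thesis
    using nz by simp
qed

text \<open>A root of unity has norm 1, so conjugation inverts \<open>\<alpha> g\<close>, and so
  does passing to \<open>- g\<close>.\<close>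

lemma character_cnj:
  fixes \<alpha> :: "'g::{finite, ab_group_add} \<Rightarrow> complex"
  assumes "\<alpha> \<in> characters"
  shows "cnj (\<alpha> g) = \<alpha> (- g)"
proof -
  have \<alpha>: "\<alpha> g * \<alpha> (- g) = 1"
    using assms unfolding characters_def by (metis (mono_tags, lifting) add.right_inverse mem_Collect_eq)
  have "norm (\<alpha> g) ^ CARD('g) = 1"
    using character_root_of_unity[OF assms, of g] by (metis norm_one norm_power)
  then have "norm (\<alpha> g) = 1"
    using power_eq_iff_eq_base[of "CARD('g)" "norm (\<alpha> g)" 1] by simp
  then have "\<alpha> g * cnj (\<alpha> g) = 1"
    using complex_norm_square[of "\<alpha> g"] by simp
  with \<alpha> show ?thesis
    by (metis mult.assoc mult.commute mult.right_neutral)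
qed

text \<open>A character maps the finite group into the finitely many roots of unity. Over an
  infinite index set the sums over \<open>characters\<close> would be 0 by convention.\<close>

lemma finite_characters: "finite (characters :: ('g::{finite, ab_group_add} \<Rightarrow> complex) set)"
proof (rule finite_subset)
  let ?R = "{z::complex. z ^ CARD('g) = 1}"
  show "characters \<subseteq> {\<alpha>::'g \<Rightarrow> complex. \<forall>g. \<alpha> g \<in> ?R}"
    by (auto simp: character_root_of_unity)
  have "finite ?R"
    by (rule finite_roots_unity) (simp add: Suc_leI)
  then show "finite {\<alpha>::'g \<Rightarrow> complex. \<forall>g. \<alpha> g \<in> ?R}"
    using finite_PiE[of "UNIV :: 'g set" "\<lambda>_. ?R"] by (simp add: PiE_def Pi_def)
qed

text \<open>Elements are adjoined one at a time, each with any suitable complex root as its value;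
  the complement of the domain shrinks until the domain is the whole group.\<close>

lemma partial_character_extend:
  fixes H :: "'g::{finite, ab_group_add} set"
  assumes "partial_character H \<alpha>"
  shows "\<exists>\<beta>\<in>characters. \<forall>h\<in>H. \<beta> h = \<alpha> h"
  using assms
proof (induction "card (- H)" arbitrary: H \<alpha> rule: less_induct)
  case less
  note H = less.prems
  show ?case
  proof (cases "H = UNIV")
    case True
    then show ?thesis
      using H partial_character_UNIV by blast
  next
    case False
    then obtain x where x: "x \<notin> H"
      by blast
    define k where "k = (LEAST k. k > 0 \<and> nmult k x \<in> H)"
    have "\<exists>k>0. nmult k x \<in> H"
      using nmult_eq_0_ex[of x] H by (auto simp: partial_character_def)
    from LeastI_ex[OF this] have k: "k > 0" "nmult k x \<in> H"
      by (simp_all add: k_def)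
    have least: "nmult m x \<notin> H" if "0 < m" "m < k" for m
      using not_less_Least that unfolding k_def by blast
    obtain z where "z ^ k = \<alpha> (nmult k x)"
      using k(1) by (metis card_nth_roots exists_complex_root gr_implies_not0)
    from partial_character_extend_one[OF H k least this]
    obtain K \<beta> where K: "partial_character K \<beta>" "H \<subseteq> K" "\<forall>h\<in>H. \<beta> h = \<alpha> h" "x \<in> K"
      by blast
    have "card (- K) < card (- H)"
      using K x by (intro psubset_card_mono) auto
    from less.hyps[OF this K(1)] K(2,3) show ?thesis
      by (metis subsetD)
  qed
qed

text \<open>With \<open>k\<close> the order of \<open>g\<close>, sending \<open>g\<close> to a
  primitive \<open>k\<close>-th root of unity gives a character of the cyclic subgroup, which then
  extends. As \<open>g \<noteq> 0\<close>, the order exceeds 1 and the root is not 1.\<close>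

lemma character_separates:
  fixes g :: "'g::{finite, ab_group_add}"
  assumes "g \<noteq> 0"
  shows "\<exists>\<alpha>\<in>characters. \<alpha> g \<noteq> 1"
proof -
  define k where "k = (LEAST k. k > 0 \<and> nmult k g = 0)"
  from LeastI_ex[OF nmult_eq_0_ex[of g]] have k: "k > 0" "nmult k g = 0"
    by (simp_all add: k_def)
  have least: "nmult m g \<noteq> 0" if "0 < m" "m < k" for m
    using not_less_Least that unfolding k_def by blast
  have "k \<noteq> 1"
    using k assms by auto
  define z where "z = exp (2 * of_real pi * \<i> * of_nat 1 / of_nat k)"
  have "z ^ k = 1"
    using complex_root_unity[of k 1] k(1) unfolding z_def by simp
  moreover have "z \<noteq> 1"
    using complex_root_unity_eq_1[of k 1] k(1) \<open>k \<noteq> 1\<close> unfolding z_def by simp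
  moreover have "partial_character {0} (\<lambda>_::'g. 1)"
    by (simp add: partial_character_def)
  ultimately obtain K \<beta> where "partial_character K \<beta>" "g \<in> K" "\<beta> g = z"
    using partial_character_extend_one[of "{0}" "\<lambda>_. 1" k g z] k least by auto
  with partial_character_extend[of K \<beta>] \<open>z \<noteq> 1\<close> show ?thesis
    by metis
qed

section \<open>Orthogonality of characters\<close>

lemma sum_character:
  fixes \<alpha> :: "'g::{finite, ab_group_add} \<Rightarrow> complex"
  assumes "\<alpha> \<in> characters"
  shows "(\<Sum>g\<in>UNIV. \<alpha> g) = (if \<alpha> = (\<lambda>_. 1) then of_nat CARD('g) else 0)"
proof (cases "\<alpha> = (\<lambda>_. 1)")
  case False
  then obtain h where h: "\<alpha> h \<noteq> 1"
    by auto
  \<comment> \<open>Translation by \<open>h\<close> multiplies the sum by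
    \<open>\<alpha> h \<noteq> 1\<close>, so the sum vanishes.\<close>
  have "(\<Sum>g\<in>UNIV. \<alpha> g) = (\<Sum>g\<in>UNIV. \<alpha> (h + g))"
    by (rule sum.reindex_bij_witness[of _ "\<lambda>g. h + g" "\<lambda>g. g - h"]) auto
  also have "\<dots> = \<alpha> h * (\<Sum>g\<in>UNIV. \<alpha> g)"
    using assms by (simp add: characters_def sum_distrib_left)
  finally show ?thesis
    using False h by simp
qed simp

lemma mult_cnj_characters:
  fixes \<alpha> \<beta> :: "'g::{finite, ab_group_add} \<Rightarrow> complex"
  assumes "\<alpha> \<in> characters" and "\<beta> \<in> characters"
  shows "(\<lambda>g. cnj (\<alpha> g) * \<beta> g) \<in> characters"
  using assms by (simp add: characters_def)

text \<open>Translates triviality of the quotient of two characters into their equality, which turns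
  \<open>sum_character\<close> into row orthogonality.\<close>

lemma cnj_mult_character_eq_1:
  fixes \<alpha> \<beta> :: "'g::{finite, ab_group_add} \<Rightarrow> complex"
  assumes "\<alpha> \<in> characters"
  shows "cnj (\<alpha> g) * \<beta> g = 1 \<longleftrightarrow> \<alpha> g = \<beta> g"
proof -
  have "cnj (\<alpha> g) * \<alpha> g = 1"
    using assms by (metis (mono_tags, lifting) add.left_inverse character_cnj characters_def mem_Collect_eq)
  then show ?thesis
    by (metis mult_cancel_left mult_zero_left zero_neq_one)
qed

lemma characters_row_orthogonality:
  fixes \<alpha> \<beta> :: "'g::{finite, ab_group_add} \<Rightarrow> complex"
  assumes "\<alpha> \<in> characters" and "\<beta> \<in> characters"
  shows "(\<Sum>g\<in>UNIV. cnj (\<alpha> g) * \<beta> g) = (if \<alpha> = \<beta> then of_nat CARD('g) else 0)"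
  using sum_character[OF mult_cnj_characters[OF assms]] cnj_mult_character_eq_1[OF assms(1)]
  by (simp add: fun_eq_iff)

text \<open>For \<open>g \<noteq> 0\<close>, multiplication by a character that is not 1 at
  \<open>g\<close> permutes the characters and rescales the sum. For \<open>g = 0\<close> the sum
  counts the characters, and a double sum over group and characters finds their number.\<close>

lemma sum_over_characters:
  fixes g :: "'g::{finite, ab_group_add}"
  shows "(\<Sum>\<alpha>\<in>characters. \<alpha> g) = (if g = 0 then of_nat CARD('g) else 0)"
proof -
  have 0: "(\<Sum>\<alpha>\<in>characters. \<alpha> h) = 0" if "h \<noteq> 0" for h :: 'g
  proof -
    obtain \<beta> where \<beta>: "\<beta> \<in> characters" "\<beta> h \<noteq> 1"
      using character_separates[OF \<open>h \<noteq> 0\<close>] by blast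
    have "cnj (\<beta> x) * \<beta> x = 1" for x
      using cnj_mult_character_eq_1[OF \<beta>(1), of x \<beta>] by simp
    then have inv: "cnj (\<beta> x) * (\<beta> x * y) = y" "\<beta> x * (cnj (\<beta> x) * y) = y" for x y
      by (metis mult.assoc mult.commute mult_1)+
    have "(\<lambda>x. \<beta> x * \<alpha> x) \<in> characters" if "\<alpha> \<in> characters" for \<alpha>
      using \<beta>(1) that by (simp add: characters_def)
    then have "(\<Sum>\<alpha>\<in>characters. \<alpha> h) = (\<Sum>\<alpha>\<in>characters. \<beta> h * \<alpha> h)"
      by (intro sum.reindex_bij_witness[of _ "\<lambda>\<alpha> x. \<beta> x * \<alpha> x" "\<lambda>\<alpha> x. cnj (\<beta> x) * \<alpha> x"])
        (simp_all add: inv mult_cnj_characters[OF \<beta>(1)])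
    then show ?thesis
      using \<beta>(2) by (simp flip: sum_distrib_left)
  qed
  have one: "(\<lambda>_::'g. 1) \<in> characters"
    by (simp add: characters_def)
  \<comment> \<open>The terms with \<open>h \<noteq> 0\<close> vanish, so they may be added; after
    the swap only the trivial character contributes.\<close>
  have "(\<Sum>\<alpha>\<in>characters. \<alpha> (0::'g)) = (\<Sum>h::'g\<in>UNIV. \<Sum>\<alpha>\<in>characters. \<alpha> h)"
    using 0 by (subst sum.remove[of _ 0]) auto
  also have "\<dots> = (\<Sum>\<alpha>\<in>characters. \<Sum>h::'g\<in>UNIV. \<alpha> h)"
    by (rule sum.swap)
  also have "\<dots> = of_nat CARD('g)"
    using one by (simp add: sum_character finite_characters)
  finally show ?thesis
    using 0 by auto
qed

lemma characters_column_orthogonality: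
  fixes g h :: "'g::{finite, ab_group_add}"
  shows "(\<Sum>\<alpha>\<in>characters. \<alpha> g * cnj (\<alpha> h)) = (if g = h then of_nat CARD('g) else 0)"
proof -
  have "(\<Sum>\<alpha>\<in>characters. \<alpha> g * cnj (\<alpha> h)) = (\<Sum>\<alpha>\<in>characters. \<alpha> (g + - h))"
    by (intro sum.cong refl, subst character_cnj) (auto simp: characters_def simp del: add_uminus_conv_diff)
  then show ?thesis
    by (simp add: sum_over_characters)
qed


section \<open>Primitive idempotents from eigenmatrices\<close>

lemma mat_smult_sum_right: "mat_smult (a::'a::comm_ring_1) (\<Sum>i\<in>I. f i) = (\<Sum>i\<in>I. mat_smult a (f i))"
  by (simp add: mat_smult_def vec_eq_iff sum_distrib_left)

lemma mat_smult_sum_left: "mat_smult (\<Sum>i\<in>I. a i :: 'a::comm_ring_1) M = (\<Sum>i\<in>I. mat_smult (a i) M)"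
  by (simp add: mat_smult_def vec_eq_iff sum_distrib_right)

lemma mat_smult_mat_smult [simp]: "mat_smult (a::'a::comm_ring_1) (mat_smult b M) = mat_smult (a * b) M"
  by (simp add: mat_smult_def vec_eq_iff mult_ac)

lemma mat_smult_1 [simp]: "mat_smult (1::'a::comm_ring_1) M = M"
  by (simp add: mat_smult_def vec_eq_iff)

lemma mat_smult_0 [simp]: "mat_smult (0::'a::comm_ring_1) M = 0"
  by (simp add: mat_smult_def vec_eq_iff)

lemma mat_smult_add_right: "mat_smult (a::'a::comm_ring_1) (M + N) = mat_smult a M + mat_smult a N"
  by (simp add: mat_smult_def vec_eq_iff algebra_simps)

lemma mat_smult_add_left: "mat_smult (a + b ::'a::comm_ring_1) M = mat_smult a M + mat_smult b M"
  by (simp add: mat_smult_def vec_eq_iff algebra_simps)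

lemma mat_smult_mult_left: "mat_smult (a::'a::comm_ring_1) M ** N = mat_smult a (M ** N)"
  by (simp add: mat_smult_def matrix_matrix_mult_def vec_eq_iff sum_distrib_left mult_ac)

lemma mat_smult_mult_right: "M ** mat_smult (a::'a::comm_ring_1) N = mat_smult a (M ** N)"
  by (simp add: mat_smult_def matrix_matrix_mult_def vec_eq_iff sum_distrib_left mult_ac)

lemma matrix_mult_add_left: "(M + N) ** (X :: 'a::comm_ring_1 ^ 'n ^ 'm) = M ** X + N ** X"
  by (simp add: matrix_matrix_mult_def vec_eq_iff algebra_simps sum.distrib)

lemma matrix_mult_diff_left: "(M - N) ** (X :: 'a::comm_ring_1 ^ 'n ^ 'm) = M ** X - N ** X"
  by (simp add: matrix_matrix_mult_def vec_eq_iff algebra_simps sum_subtractf)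

lemma matrix_mult_diff_right: "(X :: 'a::comm_ring_1 ^ 'n ^ 'm) ** (M - N) = X ** M - X ** N"
  by (simp add: matrix_matrix_mult_def vec_eq_iff algebra_simps sum_subtractf)

lemma matrix_mult_sum_left: "(\<Sum>i\<in>I. f i) ** (N :: 'a::comm_ring_1 ^ 'n ^ 'm) = (\<Sum>i\<in>I. f i ** N)"
  by (induction I rule: infinite_finite_induct) (simp_all add: matrix_mult_add_left)

lemma matrix_mult_sum_right: "(M :: 'a::comm_ring_1 ^ 'n ^ 'm) ** (\<Sum>i\<in>I. f i) = (\<Sum>i\<in>I. M ** f i)"
  by (induction I rule: infinite_finite_induct) (simp_all add: matrix_add_ldistrib)

lemma mat_smult_eq_iff:
  fixes M :: "'a::idom ^ 'n ^ 'm"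
  assumes "M \<noteq> 0"
  shows "mat_smult a M = mat_smult b M \<longleftrightarrow> a = b"
  using assms by (auto simp: mat_smult_def vec_eq_iff)

section \<open>The adjacency algebra and its primitive idempotents\<close>

lemma adjacency_algebra_explicit:
  fixes A :: "'r::finite \<Rightarrow> complex ^ 'v ^ 'v"
  shows "X \<in> adjacency_algebra A \<longleftrightarrow> (\<exists>x. X = (\<Sum>r\<in>UNIV. mat_smult (x r) (A r)))"
proof -
  interpret module "mat_smult :: complex \<Rightarrow> complex ^ 'v ^ 'v \<Rightarrow> _"
    by (rule module_mat_smult)
  show ?thesis
  proof
    assume "X \<in> adjacency_algebra A"
    then have "X \<in> span (range A)"
      by (simp add: adjacency_algebra_def)
    then show "\<exists>x. X = (\<Sum>r\<in>UNIV. mat_smult (x r) (A r))"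
    proof (induction rule: span_induct_alt)
      case base
      show ?case
        by (rule exI[of _ "\<lambda>_. 0"]) simp
    next
      case (step a M Y)
      then obtain s x where "M = A s" "Y = (\<Sum>r\<in>UNIV. mat_smult (x r) (A r))"
        by blast
      then have "mat_smult a M + Y = (\<Sum>r\<in>UNIV. mat_smult ((if r = s then a else 0) + x r) (A r))"
        by (simp add: scale_left_distrib sum.distrib if_distrib[of "\<lambda>a. mat_smult a _"] cong: if_cong)
      then show ?case
        by (rule exI[of _ "\<lambda>r. (if r = s then a else 0) + x r"])
    qed
  next
    assume "\<exists>x. X = (\<Sum>r\<in>UNIV. mat_smult (x r) (A r))"
    then show "X \<in> adjacency_algebra A"
      unfolding adjacency_algebra_def by (elim exE ssubst) (intro span_sum span_scale span_base rangeI)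
  qed
qed

text \<open>Zero-one matrices that sum to the all-ones matrix have disjoint supports, so a position
  in the support of \<open>A s\<close> reads off \<open>x s\<close>.\<close>

lemma adjacency_matrices_independent:
  assumes "commutative_scheme A" and "(\<Sum>r\<in>UNIV. mat_smult (x r) (A r)) = 0"
  shows "x s = 0"
proof -
  have A01: "A r $ u $ v \<in> {0, 1}" and "A s \<noteq> 0" and J: "(\<Sum>r\<in>UNIV. A r) = (\<chi> x y. 1)" for r u v
    using assms(1) by (auto simp: commutative_scheme_def)
  then obtain u v where "A s $ u $ v \<noteq> 0"
    by (auto simp: vec_eq_iff)
  then have s1: "A s $ u $ v = 1"
    using A01 by blast
  have "(\<Sum>r\<in>UNIV. A r) $ u $ v = 1"
    by (simp add: J)
  then have "(\<Sum>r\<in>UNIV - {s}. A r $ u $ v) = 0"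
    using s1 by (simp add: sum.remove[of UNIV s])
  \<comment> \<open>Real parts are nonnegative, so a vanishing sum forces each of them to
    vanish.\<close>
  then have "(\<Sum>r\<in>UNIV - {s}. Re (A r $ u $ v)) = 0"
    by (metis Re_sum zero_complex.simps(1))
  moreover have "0 \<le> Re (A r $ u $ v)" for r
    using A01[of r u v] by auto
  ultimately have "Re (A r $ u $ v) = 0" if "r \<noteq> s" for r
    using that by (subst (asm) sum_nonneg_eq_0_iff) auto
  then have r0: "A r $ u $ v = 0" if "r \<noteq> s" for r
    using that A01[of r u v] by fastforce
  have "(\<Sum>r\<in>UNIV. mat_smult (x r) (A r)) $ u $ v = (\<Sum>r\<in>UNIV. x r * A r $ u $ v)"
    by (simp add: mat_smult_def)
  also have "\<dots> = x s"
    using r0 s1 by (subst sum.remove[of _ s]) auto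
  finally show ?thesis
    using assms(2) by simp
qed

text \<open>In the coordinates given by \<open>E\<close> the algebra multiplies componentwise. Its
  idempotents are the zero-one vectors, and the indecomposable ones are the unit vectors.\<close>

lemma primitive_idempotents_eq_image:
  fixes A :: "'r::finite \<Rightarrow> complex ^ 'v ^ 'v"
  assumes I: "finite I" and E_in: "\<And>i. i \<in> I \<Longrightarrow> E i \<in> adjacency_algebra A"
    and nz: "\<And>i. i \<in> I \<Longrightarrow> E i \<noteq> 0"
    and orth: "\<And>i j. i \<in> I \<Longrightarrow> j \<in> I \<Longrightarrow> E i ** E j = (if i = j then E i else 0)"
    and span: "first_eigenmatrix A I E P"
  shows "primitive_idempotents A = E ` I"
proof -
  interpret module "mat_smult :: complex \<Rightarrow> complex ^ 'v ^ 'v \<Rightarrow> _"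
    by (rule module_mat_smult)
  have expand: "\<exists>x. X = (\<Sum>i\<in>I. mat_smult (x i) (E i))" if "X \<in> adjacency_algebra A" for X
  proof -
    have "\<exists>y. X = (\<Sum>r\<in>UNIV. mat_smult (y r) (A r))"
      using that unfolding adjacency_algebra_explicit .
    then obtain y where "X = (\<Sum>r\<in>UNIV. mat_smult (y r) (A r))" ..
    also have "\<dots> = (\<Sum>r\<in>UNIV. mat_smult (y r) (\<Sum>i\<in>I. mat_smult (P i r) (E i)))"
      using span by (simp add: first_eigenmatrix_def)
    also have "\<dots> = (\<Sum>i\<in>I. mat_smult (\<Sum>r\<in>UNIV. y r * P i r) (E i))"
      unfolding mat_smult_sum_right mat_smult_mat_smult by (subst sum.swap) (simp add: mat_smult_sum_left)
    finally show ?thesis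
      by (rule exI[of _ "\<lambda>i. \<Sum>r\<in>UNIV. y r * P i r"])
  qed
  have mult_E: "(\<Sum>j\<in>I. mat_smult (x j) (E j)) ** E i = mat_smult (x i) (E i)"
    and E_mult: "E i ** (\<Sum>j\<in>I. mat_smult (x j) (E j)) = mat_smult (x i) (E i)" if "i \<in> I" for i x
  proof -
    have "(\<Sum>j\<in>I. mat_smult (x j) (E j)) ** E i = (\<Sum>j\<in>I. if j = i then mat_smult (x i) (E i) else 0)"
      unfolding matrix_mult_sum_left mat_smult_mult_left using that
      by (intro sum.cong) (auto simp: orth)
    then show "(\<Sum>j\<in>I. mat_smult (x j) (E j)) ** E i = mat_smult (x i) (E i)"
      using I that by simp
    have "E i ** (\<Sum>j\<in>I. mat_smult (x j) (E j)) = (\<Sum>j\<in>I. if j = i then mat_smult (x i) (E i) else 0)"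
      unfolding matrix_mult_sum_right mat_smult_mult_right using that
      by (intro sum.cong) (auto simp: orth)
    then show "E i ** (\<Sum>j\<in>I. mat_smult (x j) (E j)) = mat_smult (x i) (E i)"
      using I that by simp
  qed
  have coeff: "x i = 0 \<or> x i = 1"
    if "X = (\<Sum>j\<in>I. mat_smult (x j) (E j))" "X ** X = X" "i \<in> I" for X x i
  proof -
    have "mat_smult (x i) (E i) = X ** X ** E i"
      using that mult_E by simp
    also have "\<dots> = mat_smult (x i * x i) (E i)"
      using that(1) mult_E[OF that(3), of x] by (simp add: mat_smult_mult_right flip: matrix_mul_assoc)
    finally show ?thesis
      using mat_smult_eq_iff[OF nz[OF that(3)]] by simp
  qed
  show ?thesis
  proof (intro equalityI subsetI)
    fix X
    assume "X \<in> primitive_idempotents A"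
    then have X: "X \<in> adjacency_algebra A" "X \<noteq> 0" "X ** X = X"
      and prim: "\<And>F F'. F \<in> adjacency_algebra A \<Longrightarrow> F' \<in> adjacency_algebra A \<Longrightarrow> X = F + F' \<Longrightarrow>
        F ** F = F \<Longrightarrow> F' ** F' = F' \<Longrightarrow> F ** F' = 0 \<Longrightarrow> F' ** F = 0 \<Longrightarrow> F = 0 \<or> F' = 0"
      unfolding primitive_idempotents_def by blast+
    obtain x where x: "X = (\<Sum>i\<in>I. mat_smult (x i) (E i))"
      using expand X(1) by blast
    \<comment> \<open>A nonzero idempotent has some coordinate 1. Splitting \<open>X\<close> into
      the orthogonal idempotents \<open>E i\<close> and \<open>X - E i\<close>, primitivity leaves
      \<open>X = E i\<close>.\<close>
    obtain i where i: "i \<in> I" "x i \<noteq> 0"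
      using X(2) unfolding x by (metis (no_types, lifting) mat_smult_0 sum.neutral)
    then have "x i = 1"
      using coeff[OF x X(3)] by blast
    then have XE: "X ** E i = E i" "E i ** X = E i" and EE: "E i ** E i = E i"
      using mult_E[OF i(1), of x] E_mult[OF i(1), of x] orth[of i i] i x by simp_all
    have "X - E i \<in> adjacency_algebra A"
      using X(1) E_in[OF i(1)] unfolding adjacency_algebra_def by (rule span_diff)
    then have "E i = 0 \<or> X - E i = 0"
      using E_in[OF i(1)] X(3) XE EE
      by (intro prim) (simp_all add: matrix_mult_diff_left matrix_mult_diff_right)
    then show "X \<in> E ` I"
      using nz i by auto
  next
    fix X
    assume "X \<in> E ` I"
    then obtain i where i: "i \<in> I" "X = E i"
      by blast
    have "F = 0 \<or> F' = 0"
      if F: "F \<in> adjacency_algebra A" "E i = F + F'" "F ** F = F" "F ** F' = 0" for F F'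
    proof -
      obtain f where f: "F = (\<Sum>j\<in>I. mat_smult (f j) (E j))"
        using expand F(1) by blast
      \<comment> \<open>Orthogonality to the other summand gives this, so \<open>F\<close> is a
        multiple of \<open>E i\<close>, and idempotency leaves only the factors 0 and 1.\<close>
      have "F = F ** E i"
        using F by (simp add: matrix_add_ldistrib)
      also have "\<dots> = mat_smult (f i) (E i)"
        unfolding f by (rule mult_E[OF i(1)])
      finally have "F = mat_smult (f i) (E i)" .
      moreover have "f i = 0 \<or> f i = 1"
        by (rule coeff[OF f F(3) i(1)])
      ultimately have "F = 0 \<or> F = E i"
        by auto
      then show ?thesis
        using F(2) by auto
    qed
    then show "X \<in> primitive_idempotents A"
      using i E_in nz orth[of i i] unfolding primitive_idempotents_def by auto
  qed
qed

text \<open>Inverting the expansion of \<open>A\<close> in \<open>E\<close> dictates the formula for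
  \<open>E\<close>. Then \<open>Q P = d I\<close> recovers \<open>A\<close>, while
  \<open>P Q = d I\<close> and the eigenvalue equations give the products of the
  \<open>E i\<close>.\<close>

theorem primitive_idempotents_from_eigenmatrices:
  fixes A :: "'r::finite \<Rightarrow> complex ^ 'v ^ 'v" and Q :: "'r \<Rightarrow> 'i \<Rightarrow> complex"
  assumes A: "commutative_scheme A" and I: "finite I" and d: "d > 0"
    and PQ: "second_eigenmatrix d I P Q"
    and E: "E = (\<lambda>i. mat_smult (1 / of_nat d) (\<Sum>r\<in>UNIV. mat_smult (Q r i) (A r)))"
    and eig: "\<And>s i. i \<in> I \<Longrightarrow> A s ** E i = mat_smult (P i s) (E i)"
  shows "bij_betw E I (primitive_idempotents A)" and "first_eigenmatrix A I E P"
proof -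
  have PQ1: "(\<Sum>r\<in>UNIV. P i r * Q r j) = (if i = j then of_nat d else 0)"
    if "i \<in> I" "j \<in> I" for i j
    using PQ that by (auto simp: second_eigenmatrix_def)
  have QP: "(\<Sum>i\<in>I. Q r i * P i s) = (if r = s then of_nat d else 0)" for r s
    using PQ by (auto simp: second_eigenmatrix_def)
  have E': "E i = (\<Sum>r\<in>UNIV. mat_smult (Q r i / of_nat d) (A r))" for i
    by (simp add: E mat_smult_sum_right)
  show span: "first_eigenmatrix A I E P"
    unfolding first_eigenmatrix_def
  proof
    fix s
    have "(\<Sum>i\<in>I. mat_smult (P i s) (E i)) =
        (\<Sum>r\<in>UNIV. mat_smult ((\<Sum>i\<in>I. Q r i * P i s) / of_nat d) (A r))"
      unfolding E' mat_smult_sum_right mat_smult_mat_smult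
      by (subst sum.swap) (simp add: mat_smult_sum_left sum_divide_distrib mult.commute)
    also have "\<dots> = A s"
      using d by (simp add: QP if_distrib[of "\<lambda>a. mat_smult (a / _) _"] cong: if_cong)
    finally show "A s = (\<Sum>i\<in>I. mat_smult (P i s) (E i))" ..
  qed
  have nz: "E i \<noteq> 0" if "i \<in> I" for i
  proof
    \<comment> \<open>Independence of the adjacency matrices would make column \<open>i\<close> of
      \<open>Q\<close> zero, against the diagonal entry \<open>d\<close> of
      \<open>P Q\<close>.\<close>
    assume "E i = 0"
    then have "Q r i / of_nat d = 0" for r
      unfolding E' by (rule adjacency_matrices_independent[OF A])
    then have "Q r i = 0" for r
      using d by simp
    then show False
      using PQ1[OF that that] d by simp
  qed
  have orth: "E i ** E j = (if i = j then E i else 0)" if "i \<in> I" "j \<in> I" for i j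
  proof -
    \<comment> \<open>Each \<open>A r\<close> acts on \<open>E j\<close> as the scalar
      \<open>P j r\<close>, so \<open>E i\<close> acts as the \<open>(j, i)\<close> entry of
      \<open>P Q\<close> divided by \<open>d\<close>.\<close>
    have "E i ** E j = mat_smult ((\<Sum>r\<in>UNIV. P j r * Q r i) / of_nat d) (E j)"
      unfolding E'[of i] matrix_mult_sum_left mat_smult_mult_left eig[OF that(2)]
      by (simp add: mat_smult_sum_left sum_divide_distrib mult.commute)
    then show ?thesis
      using d PQ1[OF that(2,1)] by auto
  qed
  have "E i \<in> adjacency_algebra A" for i
    unfolding adjacency_algebra_explicit E' by (intro exI[of _ "\<lambda>r. Q r i / of_nat d"] refl)
  then have "primitive_idempotents A = E ` I"
    using I nz orth span by (intro primitive_idempotents_eq_image) auto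
  moreover have "inj_on E I"
    using orth nz by (metis inj_onI)
  ultimately show "bij_betw E I (primitive_idempotents A)"
    by (simp add: bij_betw_def)
qed


section \<open>The eigenmatrices of a roux scheme\<close>

lemma group_elem_mult: "group_elem g * group_elem h = (group_elem (g + h) :: 'g::comm_monoid_add \<Rightarrow>\<^sub>0 complex)"
  by (simp add: mult_single)

lemma block_rep_add: "block_rep (M + N) = block_rep M + block_rep N"
  by (simp add: vec_eq_iff block_rep_nth lookup_add)

lemma roux_scheme_Thin_mult_Thin:
  "roux_scheme B (Thin g) ** roux_scheme B (Thin h) = roux_scheme B (Thin (g + h))"
  by (simp add: block_rep_mult mat_smult_mult_left mat_smult_mult_right group_elem_mult add.commute)

lemma roux_scheme_Thin_mult_Thick:
  "roux_scheme B (Thin g) ** roux_scheme B (Thick h) = roux_scheme B (Thick (g + h))"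
  by (simp add: block_rep_mult mat_smult_mult_left mat_smult_mult_right group_elem_mult add.commute)

lemma roux_scheme_Thick_mult_Thin:
  "roux_scheme B (Thick g) ** roux_scheme B (Thin h) = roux_scheme B (Thick (g + h))"
  by (simp add: block_rep_mult mat_smult_mult_left mat_smult_mult_right group_elem_mult add.commute)

lemma roux_scheme_Thick_mult_Thick:
  fixes B :: "('g::{finite, ab_group_add} \<Rightarrow>\<^sub>0 complex) ^ 'n ^ 'n"
  assumes "roux_parameters B c" and n: "CARD('n) = n + 1"
  shows "roux_scheme B (Thick g) ** roux_scheme B (Thick h) =
    mat_smult (of_nat n) (roux_scheme B (Thin (g + h))) +
    (\<Sum>k\<in>UNIV. mat_smult (c k) (roux_scheme B (Thick (g + h + k))))"
proof -
  \<comment> \<open>Written as a complex scalar of the group algebra, the factor \<open>n\<close>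
    can be moved out by \<open>block_rep_smult\<close>.\<close>
  have mat_n: "(mat (of_nat n) :: ('g \<Rightarrow>\<^sub>0 complex) ^ 'n ^ 'n)
      = mat_smult (Poly_Mapping.single 0 (of_nat n)) (mat 1)"
    by (simp add: vec_eq_iff mat_smult_def mat_def)
  have BB: "B ** B = mat (of_nat n) +
      (\<Sum>k\<in>UNIV. mat_smult (Poly_Mapping.single 0 (c k)) (mat_smult (group_elem k) B))"
    using assms by (simp add: roux_parameters_def)
  have "roux_scheme B (Thick g) ** roux_scheme B (Thick h) =
      block_rep (mat_smult (group_elem (g + h)) (B ** B))"
    by (simp add: block_rep_mult mat_smult_mult_left mat_smult_mult_right group_elem_mult add.commute)
  also have "mat_smult (group_elem (g + h)) (B ** B) =
      mat_smult (Poly_Mapping.single 0 (of_nat n)) (mat_smult (group_elem (g + h)) (mat 1)) +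
      (\<Sum>k\<in>UNIV. mat_smult (Poly_Mapping.single 0 (c k)) (mat_smult (group_elem (g + h + k)) B))"
    by (simp add: BB mat_n mat_smult_add_right mat_smult_sum_right mult_single mult.commute add_ac)
  finally show ?thesis
    by (simp only: block_rep_add block_rep_sum block_rep_smult roux_scheme.simps)
qed

lemma sum_roux_rel: "(\<Sum>r\<in>UNIV. f r) = (\<Sum>g\<in>UNIV. f (Thin g)) + (\<Sum>g\<in>UNIV. f (Thick g))"
  for f :: "'g::finite roux_rel \<Rightarrow> 'b::comm_monoid_add"
  unfolding UNIV_roux_rel by (subst sum.union_disjoint) (auto simp: sum.reindex inj_on_def)

lemma UNIV_sign: "UNIV = {Plus, Minus}"
  using sign.exhaust by blast

lemma sum_sign: "(\<Sum>\<epsilon>\<in>UNIV. f \<epsilon>) = f Plus + f Minus"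
  by (simp add: UNIV_sign)

text \<open>Shifting the index by \<open>h\<close> brings out \<open>\<alpha> (- h)\<close>. This is
  why translations act as scalars on character sums.\<close>

lemma sum_character_translate:
  fixes \<alpha> :: "'g::{finite, ab_group_add} \<Rightarrow> complex"
  assumes "\<alpha> \<in> characters"
  shows "(\<Sum>g\<in>UNIV. mat_smult (\<alpha> g) (F (h + g))) = mat_smult (cnj (\<alpha> h)) (\<Sum>g\<in>UNIV. mat_smult (\<alpha> g) (F g))"
proof -
  have "(\<Sum>g\<in>UNIV. mat_smult (\<alpha> g) (F (h + g))) = (\<Sum>g\<in>UNIV. mat_smult (\<alpha> (- h + g)) (F g))"
    by (rule sum.reindex_bij_witness[of _ "\<lambda>g. - h + g" "\<lambda>g. h + g"]) auto
  also have "\<dots> = (\<Sum>g\<in>UNIV. mat_smult (cnj (\<alpha> h) * \<alpha> g) (F g))"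
    unfolding character_cnj[OF assms] using assms unfolding characters_def by (metis (mono_tags, lifting) mem_Collect_eq)
  finally show ?thesis
    by (simp add: mat_smult_sum_right)
qed

lemma roux_scheme_eigenvectors:
  fixes B :: "('g::{finite, ab_group_add} \<Rightarrow>\<^sub>0 complex) ^ 'n ^ 'n"
  assumes c: "roux_parameters B c" and n: "CARD('n) = n + 1" and \<alpha>: "\<alpha> \<in> characters"
    and \<mu>: "of_nat n * \<mu>\<^sup>2 = 1 + roux_hat c \<alpha> * \<mu>"
    and E: "E = (\<Sum>g\<in>UNIV. mat_smult (\<alpha> g) (roux_scheme B (Thin g))) +
      mat_smult \<mu> (\<Sum>g\<in>UNIV. mat_smult (\<alpha> g) (roux_scheme B (Thick g)))"
  shows "roux_scheme B (Thin h) ** E = mat_smult (cnj (\<alpha> h)) E"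
    and "roux_scheme B (Thick h) ** E = mat_smult (of_nat n * \<mu> * cnj (\<alpha> h)) E"
proof -
  define X where "X = (\<Sum>g\<in>UNIV. mat_smult (\<alpha> g) (roux_scheme B (Thin g)))"
  define Y where "Y = (\<Sum>g\<in>UNIV. mat_smult (\<alpha> g) (roux_scheme B (Thick g)))"
  have E: "E = X + mat_smult \<mu> Y"
    by (simp add: E X_def Y_def)
  note mult = matrix_mult_sum_right mat_smult_mult_right roux_scheme_Thin_mult_Thin
    roux_scheme_Thin_mult_Thick roux_scheme_Thick_mult_Thin
  have TX: "roux_scheme B (Thin h) ** X = mat_smult (cnj (\<alpha> h)) X"
    unfolding X_def mult by (rule sum_character_translate[OF \<alpha>])
  have TY: "roux_scheme B (Thin h) ** Y = mat_smult (cnj (\<alpha> h)) Y"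
    unfolding Y_def mult by (rule sum_character_translate[OF \<alpha>])
  have SX: "roux_scheme B (Thick h) ** X = mat_smult (cnj (\<alpha> h)) Y"
    unfolding X_def Y_def mult by (rule sum_character_translate[OF \<alpha>])
  \<comment> \<open>The thick part of the product with \<open>Y\<close>: the translates by
    \<open>k\<close>, weighted by \<open>c k\<close>, add up to the factor
    \<open>roux_hat c \<alpha>\<close>.\<close>
  have "(\<Sum>g\<in>UNIV. mat_smult (\<alpha> g) (\<Sum>k\<in>UNIV. mat_smult (c k) (roux_scheme B (Thick (h + g + k)))))
      = (\<Sum>k\<in>UNIV. mat_smult (c k) (\<Sum>g\<in>UNIV. mat_smult (\<alpha> g) (roux_scheme B (Thick ((h + k) + g)))))"
    unfolding mat_smult_sum_right mat_smult_mat_smult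
    by (subst sum.swap) (simp add: mult.commute add_ac del: roux_scheme.simps)
  also have "\<dots> = (\<Sum>k\<in>UNIV. mat_smult (c k) (mat_smult (cnj (\<alpha> (h + k))) Y))"
    unfolding Y_def by (simp only: sum_character_translate[OF \<alpha>, of "\<lambda>g. roux_scheme B (Thick g)"])
  also have "\<dots> = mat_smult (\<Sum>k\<in>UNIV. cnj (\<alpha> h) * (c k * cnj (\<alpha> k))) Y"
    unfolding mat_smult_sum_left mat_smult_mat_smult
    by (intro sum.cong refl) (use \<alpha> in \<open>simp add: characters_def mult_ac\<close>)
  also have "\<dots> = mat_smult (cnj (\<alpha> h) * roux_hat c \<alpha>) Y"
    by (simp add: roux_hat_def sum_distrib_left)
  finally have SY: "roux_scheme B (Thick h) ** Y =
      mat_smult (cnj (\<alpha> h)) (mat_smult (of_nat n) X) + mat_smult (cnj (\<alpha> h) * roux_hat c \<alpha>) Y"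
    using sum_character_translate[OF \<alpha>, of "\<lambda>g. mat_smult (of_nat n) (roux_scheme B (Thin g))" h]
    unfolding Y_def mult roux_scheme_Thick_mult_Thick[OF c n] mat_smult_add_right sum.distrib
    by (simp add: X_def mat_smult_sum_right mult.commute del: roux_scheme.simps)
  show "roux_scheme B (Thin h) ** E = mat_smult (cnj (\<alpha> h)) E"
    unfolding E by (simp add: matrix_add_ldistrib mat_smult_mult_right TX TY mat_smult_add_right
        mult.commute del: roux_scheme.simps)
  have "roux_scheme B (Thick h) ** E =
      mat_smult (of_nat n * \<mu> * cnj (\<alpha> h)) X + mat_smult (cnj (\<alpha> h) * (1 + roux_hat c \<alpha> * \<mu>)) Y"
    unfolding E by (simp add: matrix_add_ldistrib mat_smult_mult_right SX SY mat_smult_add_right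
        mat_smult_add_left algebra_simps del: roux_scheme.simps)
  \<comment> \<open>The quadratic for \<open>\<mu>\<close> turns the coefficient
    \<open>1 + roux_hat c \<alpha> * \<mu>\<close> of \<open>Y\<close> into
    \<open>n * \<mu>\<^sup>2\<close>, which makes the result proportional to
    \<open>E\<close>.\<close>
  also have "\<dots> = mat_smult (of_nat n * \<mu> * cnj (\<alpha> h)) E"
    unfolding E \<mu>[symmetric] by (simp add: mat_smult_add_right power2_eq_square mult_ac)
  finally show "roux_scheme B (Thick h) ** E = mat_smult (of_nat n * \<mu> * cnj (\<alpha> h)) E" .
qed

section \<open>Symmetry and reality of the roux parameters\<close>

lemma is_roux_lookup:
  assumes "is_roux B"
  shows "Poly_Mapping.lookup (B $ j $ i) g = Poly_Mapping.lookup (B $ i $ j) (- g)"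
    and "Poly_Mapping.lookup (B $ i $ j) g \<in> \<real>"
proof -
  have "Poly_Mapping.lookup (B $ j $ i) g = Poly_Mapping.lookup (B $ i $ j) (- g) \<and>
    Poly_Mapping.lookup (B $ i $ j) g \<in> \<real>"
  proof (cases "i = j")
    case True
    then show ?thesis
      using assms by (simp add: is_roux_def)
  next
    case False
    then obtain h where "B $ i $ j = group_elem h" "B $ j $ i = group_elem (- h)"
      using assms unfolding is_roux_def by blast
    then show ?thesis
      by (auto simp: lookup_single when_def)
  qed
  then show "Poly_Mapping.lookup (B $ j $ i) g = Poly_Mapping.lookup (B $ i $ j) (- g)"
    and "Poly_Mapping.lookup (B $ i $ j) g \<in> \<real>"
    by auto
qed

text \<open>\<open>B\<close> is Hermitian for the involution of the group algebra that negates group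
  elements; as that algebra is commutative, the square is Hermitian too.\<close>

lemma roux_square_lookup:
  fixes B :: "('g::{finite, ab_group_add} \<Rightarrow>\<^sub>0 complex) ^ 'n ^ 'n"
  assumes "is_roux B"
  shows "Poly_Mapping.lookup ((B ** B) $ j $ i) g = Poly_Mapping.lookup ((B ** B) $ i $ j) (- g)"
    and "Poly_Mapping.lookup ((B ** B) $ i $ j) g \<in> \<real>"
proof -
  have entry: "Poly_Mapping.lookup ((B ** B) $ i $ j) g =
      (\<Sum>k\<in>UNIV. \<Sum>l\<in>UNIV. Poly_Mapping.lookup (B $ i $ k) l * Poly_Mapping.lookup (B $ k $ j) (g - l))"
    for i j g
    by (simp add: matrix_matrix_mult_def lookup_sum lookup_times_finite)
  have "(\<Sum>l\<in>UNIV. Poly_Mapping.lookup (B $ j $ k) l * Poly_Mapping.lookup (B $ k $ i) (g - l)) =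
      (\<Sum>l\<in>UNIV. Poly_Mapping.lookup (B $ i $ k) l * Poly_Mapping.lookup (B $ k $ j) (- g - l))" for k
    by (rule sum.reindex_bij_witness[of _ "\<lambda>l. g + l" "\<lambda>l. l - g"])
      (auto simp: is_roux_lookup(1)[OF assms, of j k] is_roux_lookup(1)[OF assms, of k i])
  then show "Poly_Mapping.lookup ((B ** B) $ j $ i) g = Poly_Mapping.lookup ((B ** B) $ i $ j) (- g)"
    by (simp add: entry)
  show "Poly_Mapping.lookup ((B ** B) $ i $ j) g \<in> \<real>"
    unfolding entry by (intro sum_in_Reals Reals_mult is_roux_lookup(2)[OF assms])
qed

text \<open>Size at least 2 supplies an off-diagonal position, where the identity contributes
  nothing: there \<open>B ** B\<close> holds \<open>c\<close> shifted by \<open>b\<close>, and at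
  the transposed position \<open>c\<close> shifted by \<open>- b\<close>. Comparing the two shows
  that \<open>c\<close> is even.\<close>

lemma roux_parameters_symmetric_real:
  fixes B :: "('g::{finite, ab_group_add} \<Rightarrow>\<^sub>0 complex) ^ 'n ^ 'n"
  assumes B: "is_roux B" and c: "roux_parameters B c" and N: "CARD('n) \<ge> 2"
  shows "c (- g) = c g" and "c g \<in> \<real>"
proof -
  obtain i j :: 'n where ij: "i \<noteq> j"
    using N card_le_Suc0_iff_eq[of "UNIV :: 'n set"] by fastforce
  then obtain b where b: "B $ i $ j = group_elem b" "B $ j $ i = group_elem (- b)"
    using B unfolding is_roux_def by blast
  have entry: "Poly_Mapping.lookup ((B ** B) $ i $ j) (b + g) = c g"
    if "i \<noteq> j" "B $ i $ j = group_elem b" for i j b g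
  proof -
    have "(B ** B) $ i $ j = (\<Sum>k\<in>UNIV. Poly_Mapping.single (b + k) (c k))"
      using c that unfolding roux_parameters_def
      by (simp add: mat_def mat_smult_def mult_single add.commute)
    then show ?thesis
      by (simp add: lookup_sum lookup_single when_def)
  qed
  have "c (- g) = Poly_Mapping.lookup ((B ** B) $ j $ i) (- (b + g))"
    using entry[of j i "- b" "- g"] b ij by (simp add: add.commute)
  also have "\<dots> = c g"
    using roux_square_lookup(1)[OF B, of j i "- (b + g)", unfolded minus_minus] entry[OF ij b(1)]
    by (rule trans)
  finally show "c (- g) = c g" .
  show "c g \<in> \<real>"
    using roux_square_lookup(2)[OF B, of i j] entry[OF ij b(1)] by metis
qed

text \<open>Evenness of \<open>c\<close> absorbs the conjugation of the character, so the sum equals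
  its own conjugate.\<close>

lemma roux_hat_real:
  fixes \<alpha> :: "'g::{finite, ab_group_add} \<Rightarrow> complex"
  assumes "\<And>g. c (- g) = c g" and "\<And>g. c g \<in> \<real>" and \<alpha>: "\<alpha> \<in> characters"
  shows "roux_hat c \<alpha> \<in> \<real>"
proof -
  have "cnj (roux_hat c \<alpha>) = (\<Sum>h\<in>UNIV. c h * \<alpha> h)"
    using assms(2) by (simp add: roux_hat_def Reals_cnj_iff)
  also have "\<dots> = (\<Sum>h\<in>UNIV. c h * \<alpha> (- h))"
    by (rule sum.reindex_bij_witness[of _ uminus uminus]) (auto simp: assms(1))
  also have "\<dots> = roux_hat c \<alpha>"
    by (simp add: roux_hat_def character_cnj[OF \<alpha>])
  finally show ?thesis
    by (simp add: Reals_cnj_iff)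
qed

section \<open>The roots \<mu> and the weights \<lambda>\<close>

lemma roux_mu_quadratic:
  assumes "n \<ge> 1"
  shows "of_nat n * (roux_mu n c \<alpha> \<epsilon>)\<^sup>2 = 1 + roux_hat c \<alpha> * roux_mu n c \<alpha> \<epsilon>"
proof -
  define x where "x = roux_hat c \<alpha>"
  define s where "s = sign_val \<epsilon> * csqrt (x\<^sup>2 + 4 * of_nat n)"
  have s: "s\<^sup>2 = x\<^sup>2 + 4 * of_nat n"
    by (cases \<epsilon>) (simp_all add: s_def power_mult_distrib)
  define \<mu> where "\<mu> = roux_mu n c \<alpha> \<epsilon>"
  \<comment> \<open>Completing the square, \<open>(2 n \<mu> - x)\<^sup>2 = s\<^sup>2\<close>; the
    factor \<open>4 n\<close> keeps the computation polynomial.\<close>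
  have "2 * of_nat n * \<mu> = x + s"
    using assms by (simp add: \<mu>_def roux_mu_def x_def s_def)
  with s have "4 * of_nat n * (of_nat n * \<mu>\<^sup>2) = 4 * of_nat n * (1 + x * \<mu>)"
    by algebra
  then show ?thesis
    using assms by (simp add: x_def \<mu>_def)
qed

text \<open>The product of the two roots of the quadratic. It makes the two idempotents of one
  character orthogonal.\<close>

lemma roux_mu_Plus_Minus:
  assumes "n \<ge> 1"
  shows "of_nat n * (roux_mu n c \<alpha> Plus * roux_mu n c \<alpha> Minus) = - 1"
proof -
  define x where "x = roux_hat c \<alpha>"
  define s where "s = csqrt (x\<^sup>2 + 4 * of_nat n)"
  have s: "s\<^sup>2 = x\<^sup>2 + 4 * of_nat n"
    by (simp add: s_def)
  define p q where "p = roux_mu n c \<alpha> Plus" and "q = roux_mu n c \<alpha> Minus"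
  have "2 * of_nat n * p = x + s" "2 * of_nat n * q = x - s"
    using assms by (simp_all add: p_def q_def roux_mu_def x_def s_def)
  with s have "4 * of_nat n * (of_nat n * (p * q)) = 4 * of_nat n * (- 1)"
    by algebra
  then have "of_nat n * (p * q) = - 1"
    unfolding mult_cancel_left using assms by simp
  then show ?thesis
    by (simp add: p_def q_def)
qed

lemma roux_mu_real:
  assumes "roux_hat c \<alpha> \<in> \<real>"
  shows "roux_mu n c \<alpha> \<epsilon> \<in> \<real>"
proof -
  obtain x where x: "roux_hat c \<alpha> = of_real x"
    using assms by (auto elim: Reals_cases)
  have "csqrt ((roux_hat c \<alpha>)\<^sup>2 + 4 * of_nat n) = of_real (sqrt (x\<^sup>2 + 4 * of_nat n))"
    using of_real_sqrt[of "x\<^sup>2 + 4 * of_nat n"] by (simp add: x)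
  moreover have "sign_val \<epsilon> \<in> \<real>"
    by (cases \<epsilon>) simp_all
  ultimately show ?thesis
    unfolding roux_mu_def using assms by auto
qed

text \<open>By the quadratic the denominator of \<lambda> is \<open>1 + n \<mu>\<^sup>2\<close>,
  which is positive because \<mu> is real.\<close>

lemma roux_lambda_eq:
  assumes "n \<ge> 1" and "roux_hat c \<alpha> \<in> \<real>"
  shows "roux_lambda n c \<alpha> \<epsilon> * (1 + of_nat n * (roux_mu n c \<alpha> \<epsilon>)\<^sup>2) = of_nat n + 1"
    and "1 + of_nat n * (roux_mu n c \<alpha> \<epsilon>)\<^sup>2 \<noteq> 0"
proof -
  obtain m where m: "roux_mu n c \<alpha> \<epsilon> = of_real m"
    using roux_mu_real[OF assms(2)] Reals_cases by blast
  have "0 < 1 + of_nat n * m\<^sup>2"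
    by (simp add: add_pos_nonneg)
  then have "complex_of_real (1 + of_nat n * m\<^sup>2) \<noteq> 0"
    by (metis less_irrefl of_real_eq_0_iff)
  then show nz: "1 + of_nat n * (roux_mu n c \<alpha> \<epsilon>)\<^sup>2 \<noteq> 0"
    by (simp add: m)
  have denom: "2 + roux_hat c \<alpha> * roux_mu n c \<alpha> \<epsilon> = 1 + of_nat n * (roux_mu n c \<alpha> \<epsilon>)\<^sup>2"
    by (simp add: roux_mu_quadratic[OF assms(1)])
  show "roux_lambda n c \<alpha> \<epsilon> * (1 + of_nat n * (roux_mu n c \<alpha> \<epsilon>)\<^sup>2) = of_nat n + 1"
    unfolding roux_lambda_def denom using nz by simp
qed

text \<open>For positive real \<open>n\<close> and real \<open>x\<close>, \<open>y\<close>, the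
  plane vectors (1, sqrt(n) x) and (1, sqrt(n) y) are orthogonal, and \<open>l / (n + 1)\<close>,
  \<open>m / (n + 1)\<close> are their inverse squared norms. The conclusions say that the
  projections onto the two lines sum to the identity.\<close>

lemma two_point_weight_sums:
  fixes n x y l m :: "'a::field"
  assumes xy: "n * (x * y) = - 1" and nz: "1 + n * x\<^sup>2 \<noteq> 0"
    and l: "l * (1 + n * x\<^sup>2) = n + 1" and m: "m * (1 + n * y\<^sup>2) = n + 1"
  shows "l + m = n + 1" and "l * x + m * y = 0" and "n * (l * x\<^sup>2 + m * y\<^sup>2) = n + 1"
proof -
  \<comment> \<open>Since \<open>n * y\<^sup>2\<close> is inverse to \<open>n * x\<^sup>2\<close>,
    the weight \<open>m\<close> can be written over the same denominator as
    \<open>l\<close>.\<close>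
  have "m * (1 + n * x\<^sup>2) = n * x\<^sup>2 * (m * (1 + n * y\<^sup>2))"
    using xy by algebra
  then have m': "m * (1 + n * x\<^sup>2) = n * x\<^sup>2 * (n + 1)"
    by (simp add: m)
  have "(l + m) * (1 + n * x\<^sup>2) = (n + 1) * (1 + n * x\<^sup>2)"
    using l m' by algebra
  with nz show "l + m = n + 1"
    by simp
  have "(l * x + m * y) * (1 + n * x\<^sup>2) = 0"
    using l m' xy by algebra
  with nz show "l * x + m * y = 0"
    by simp
  have "(n * (l * x\<^sup>2 + m * y\<^sup>2)) * (1 + n * x\<^sup>2) = (n + 1) * (1 + n * x\<^sup>2)"
    using l m' xy by algebra
  with nz show "n * (l * x\<^sup>2 + m * y\<^sup>2) = n + 1"
    by simp
qed

lemma roux_weight_sums: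
  assumes n: "n \<ge> 1" and "roux_hat c \<alpha> \<in> \<real>"
  defines "l \<equiv> roux_lambda n c \<alpha>" and "m \<equiv> roux_mu n c \<alpha>"
  shows "l Plus + l Minus = of_nat n + 1"
    and "l Plus * m Plus + l Minus * m Minus = 0"
    and "of_nat n * (l Plus * (m Plus)\<^sup>2 + l Minus * (m Minus)\<^sup>2) = of_nat n + 1"
  using two_point_weight_sums[OF roux_mu_Plus_Minus[OF n] roux_lambda_eq(2)[OF assms(1,2)]
      roux_lambda_eq(1)[OF assms(1,2)] roux_lambda_eq(1)[OF assms(1,2)]]
  unfolding l_def m_def .

section \<open>The two eigenmatrices and the idempotents they determine\<close>

definition roux_P :: "nat \<Rightarrow> ('g::{finite, ab_group_add} \<Rightarrow> complex) \<Rightarrow>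
    ('g \<Rightarrow> complex) \<times> sign \<Rightarrow> 'g roux_rel \<Rightarrow> complex"
  where "roux_P n c = (\<lambda>(\<alpha>, \<epsilon>) r. case r of Thin g \<Rightarrow> cnj (\<alpha> g)
    | Thick g \<Rightarrow> of_nat n * roux_mu n c \<alpha> \<epsilon> * cnj (\<alpha> g))"

definition roux_Q :: "nat \<Rightarrow> ('g::{finite, ab_group_add} \<Rightarrow> complex) \<Rightarrow>
    'g roux_rel \<Rightarrow> ('g \<Rightarrow> complex) \<times> sign \<Rightarrow> complex"
  where "roux_Q n c r = (\<lambda>(\<alpha>, \<epsilon>). case r of Thin g \<Rightarrow> roux_lambda n c \<alpha> \<epsilon> * \<alpha> g
    | Thick g \<Rightarrow> roux_lambda n c \<alpha> \<epsilon> * roux_mu n c \<alpha> \<epsilon> * \<alpha> g)"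

text \<open>For \<open>P Q\<close>, row orthogonality separates characters and the product of the
  roots separates signs. For \<open>Q P\<close>, column orthogonality separates group elements and
  the weight sums separate thin from thick.\<close>

lemma second_eigenmatrix_roux:
  fixes c :: "'g::{finite, ab_group_add} \<Rightarrow> complex"
  assumes n: "n \<ge> 1" and real: "\<And>\<alpha>. \<alpha> \<in> characters \<Longrightarrow> roux_hat c \<alpha> \<in> \<real>"
  shows "second_eigenmatrix ((n + 1) * CARD('g)) (characters \<times> UNIV) (roux_P n c) (roux_Q n c)"
  unfolding second_eigenmatrix_def
proof (intro conjI ballI allI)
  fix i i' :: "('g \<Rightarrow> complex) \<times> sign"
  assume "i \<in> characters \<times> UNIV" "i' \<in> characters \<times> UNIV"
  then obtain \<alpha> \<epsilon> \<beta> \<delta> where i: "i = (\<alpha>, \<epsilon>)" "i' = (\<beta>, \<delta>)" and \<alpha>\<beta>: "\<alpha> \<in> characters" "\<beta> \<in> characters"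
    by auto
  have "(\<Sum>r\<in>UNIV. roux_P n c i r * roux_Q n c r i') =
      roux_lambda n c \<beta> \<delta> * (1 + of_nat n * (roux_mu n c \<alpha> \<epsilon> * roux_mu n c \<beta> \<delta>)) *
      (\<Sum>g\<in>UNIV. cnj (\<alpha> g) * \<beta> g)"
    by (simp add: sum_roux_rel roux_P_def roux_Q_def i algebra_simps sum_distrib_left)
  also have "\<dots> = (if i = i' then of_nat ((n + 1) * CARD('g)) else 0)"
  proof (cases "\<alpha> = \<beta>")
    case True
    have "roux_lambda n c \<beta> \<delta> * (1 + of_nat n * (roux_mu n c \<beta> \<epsilon> * roux_mu n c \<beta> \<delta>)) =
        (if \<epsilon> = \<delta> then of_nat n + 1 else 0)"
      using roux_lambda_eq(1)[OF n real[OF \<alpha>\<beta>(2)], of \<delta>] roux_mu_Plus_Minus[OF n, of c \<beta>]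
      by (cases \<epsilon>; cases \<delta>) (simp_all only: power2_eq_square mult.commute simp_thms if_True if_False
          sign.distinct, simp_all)
    then show ?thesis
      unfolding i True by (simp add: characters_row_orthogonality[OF \<alpha>\<beta>(2,2)] distrib_right)
  qed (simp add: characters_row_orthogonality[OF \<alpha>\<beta>] i)
  finally show "(\<Sum>r\<in>UNIV. roux_P n c i r * roux_Q n c r i') =
      (if i = i' then of_nat ((n + 1) * CARD('g)) else 0)" .
next
  fix r s :: "'g roux_rel"
  note sums = roux_weight_sums[OF n real]
  \<comment> \<open>Common form of the four cases: the sum of the weight over both signs is the same
    for all characters, namely \<open>n + 1\<close> for relations of equal type and 0 for mixed
    types.\<close>
  have weighted: "(\<Sum>\<alpha>\<in>characters. \<Sum>\<epsilon>\<in>UNIV. w \<alpha> \<epsilon> * (\<alpha> g * cnj (\<alpha> h))) =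
      (if g = h then \<kappa> * of_nat CARD('g) else 0)"
    if w: "\<And>\<alpha>. \<alpha> \<in> characters \<Longrightarrow> w \<alpha> Plus + w \<alpha> Minus = \<kappa>" for w \<kappa> and g h :: 'g
  proof -
    have "(\<Sum>\<alpha>\<in>characters. \<Sum>\<epsilon>\<in>UNIV. w \<alpha> \<epsilon> * (\<alpha> g * cnj (\<alpha> h))) =
        (\<Sum>\<alpha>\<in>characters. \<kappa> * (\<alpha> g * cnj (\<alpha> h)))"
      by (intro sum.cong refl) (simp add: sum_sign w flip: distrib_right)
    then show ?thesis
      by (simp add: characters_column_orthogonality flip: sum_distrib_left)
  qed
  have "(\<Sum>i\<in>characters \<times> UNIV. roux_Q n c r i * roux_P n c i s) =
      (\<Sum>\<alpha>\<in>characters. \<Sum>\<epsilon>\<in>UNIV. roux_Q n c r (\<alpha>, \<epsilon>) * roux_P n c (\<alpha>, \<epsilon>) s)"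
    by (simp add: sum.cartesian_product)
  also have "\<dots> = (if r = s then of_nat ((n + 1) * CARD('g)) else 0)"
  proof (cases r; cases s)
    fix g h
    assume "r = Thin g" "s = Thin h"
    with weighted[where w = "roux_lambda n c" and g = g and h = h, OF sums(1)] show ?thesis
      by (simp add: roux_P_def roux_Q_def algebra_simps)
  next
    fix g h
    assume "r = Thin g" "s = Thick h"
    moreover have "of_nat n * (roux_lambda n c \<alpha> Plus * roux_mu n c \<alpha> Plus) +
        of_nat n * (roux_lambda n c \<alpha> Minus * roux_mu n c \<alpha> Minus) = 0" if "\<alpha> \<in> characters" for \<alpha>
      using sums(2)[OF that] by (metis distrib_left mult_zero_right)
    note weighted[where w = "\<lambda>\<alpha> \<epsilon>. of_nat n * (roux_lambda n c \<alpha> \<epsilon> * roux_mu n c \<alpha> \<epsilon>)"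
        and g = g and h = h, OF this]
    ultimately show ?thesis
      by (simp add: roux_P_def roux_Q_def mult_ac)
  next
    fix g h
    assume "r = Thick g" "s = Thin h"
    with weighted[where w = "\<lambda>\<alpha> \<epsilon>. roux_lambda n c \<alpha> \<epsilon> * roux_mu n c \<alpha> \<epsilon>" and g = g and h = h,
        OF sums(2)] show ?thesis
      by (simp add: roux_P_def roux_Q_def mult_ac)
  next
    fix g h
    assume "r = Thick g" "s = Thick h"
    moreover have "of_nat n * (roux_lambda n c \<alpha> Plus * (roux_mu n c \<alpha> Plus)\<^sup>2) +
        of_nat n * (roux_lambda n c \<alpha> Minus * (roux_mu n c \<alpha> Minus)\<^sup>2) = of_nat n + 1"
      if "\<alpha> \<in> characters" for \<alpha>
      using sums(3)[OF that] by (simp only: distrib_left)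
    note weighted[where w = "\<lambda>\<alpha> \<epsilon>. of_nat n * (roux_lambda n c \<alpha> \<epsilon> * (roux_mu n c \<alpha> \<epsilon>)\<^sup>2)"
        and g = g and h = h, OF this]
    ultimately show ?thesis
      by (simp add: roux_P_def roux_Q_def power2_eq_square algebra_simps)
  qed
  finally show "(\<Sum>i\<in>characters \<times> UNIV. roux_Q n c r i * roux_P n c i s) =
      (if r = s then of_nat ((n + 1) * CARD('g)) else 0)" .
qed

theorem theorem4p1:
  fixes B :: "('g::{finite, ab_group_add} \<Rightarrow>\<^sub>0 complex) ^ 'n ^ 'n"
    and c :: "'g \<Rightarrow> complex" and n :: nat
  assumes "n \<ge> 1" and "CARD('n) = n + 1"
    and "is_roux B" and "roux_parameters B c"
  shows "\<exists>(E :: ('g \<Rightarrow> complex) \<times> sign \<Rightarrow> complex ^ ('n \<times> 'g) ^ ('n \<times> 'g)) P Q.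
    bij_betw E (characters \<times> UNIV) (primitive_idempotents (roux_scheme B)) \<and>
    first_eigenmatrix (roux_scheme B) (characters \<times> UNIV) E P \<and>
    second_eigenmatrix CARD('n \<times> 'g) (characters \<times> UNIV) P Q \<and>
    (\<forall>g. \<forall>\<alpha>\<in>characters. \<forall>\<epsilon>.
      P (\<alpha>, \<epsilon>) (Thin g) = cnj (\<alpha> g) \<and>
      P (\<alpha>, \<epsilon>) (Thick g) = of_nat n * roux_mu n c \<alpha> \<epsilon> * cnj (\<alpha> g) \<and>
      Q (Thin g) (\<alpha>, \<epsilon>) = roux_lambda n c \<alpha> \<epsilon> * \<alpha> g \<and>
      Q (Thick g) (\<alpha>, \<epsilon>) = roux_lambda n c \<alpha> \<epsilon> * roux_mu n c \<alpha> \<epsilon> * \<alpha> g)"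
proof -
  have N: "CARD('n) \<ge> 2"
    using assms(1,2) by simp
  \<comment> \<open>Reality keeps the denominators of \<open>roux_lambda\<close> away from
    0.\<close>
  have real: "roux_hat c \<alpha> \<in> \<real>" if "\<alpha> \<in> characters" for \<alpha>
    using roux_parameters_symmetric_real[OF assms(3,4) N] that by (intro roux_hat_real)
  have PQ: "second_eigenmatrix CARD('n \<times> 'g) (characters \<times> UNIV) (roux_P n c) (roux_Q n c)"
    using second_eigenmatrix_roux[OF assms(1) real] assms(2) by simp
  define E where "E = (\<lambda>i. mat_smult (1 / of_nat CARD('n \<times> 'g))
    (\<Sum>r\<in>UNIV. mat_smult (roux_Q n c r i) (roux_scheme B r)))"
  have eig: "roux_scheme B s ** E i = mat_smult (roux_P n c i s) (E i)"
    if "i \<in> characters \<times> UNIV" for s i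
  proof -
    obtain \<alpha> \<epsilon> where i: "i = (\<alpha>, \<epsilon>)" and \<alpha>: "\<alpha> \<in> characters"
      using \<open>i \<in> characters \<times> UNIV\<close> by auto
    define X where "X = (\<Sum>g\<in>UNIV. mat_smult (\<alpha> g) (roux_scheme B (Thin g))) +
      mat_smult (roux_mu n c \<alpha> \<epsilon>) (\<Sum>g\<in>UNIV. mat_smult (\<alpha> g) (roux_scheme B (Thick g)))"
    \<comment> \<open>Column \<open>i\<close> of \<open>Q\<close> is \<lambda> times the
      coefficients of the eigenvector \<open>X\<close>, so \<open>E i\<close> inherits its
      eigenvalues.\<close>
    have "(\<Sum>r\<in>UNIV. mat_smult (roux_Q n c r i) (roux_scheme B r)) = mat_smult (roux_lambda n c \<alpha> \<epsilon>) X"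
      by (simp add: X_def i sum_roux_rel roux_Q_def mat_smult_add_right mat_smult_sum_right mult_ac
          del: roux_scheme.simps)
    then have E: "E i = mat_smult (1 / of_nat CARD('n \<times> 'g)) (mat_smult (roux_lambda n c \<alpha> \<epsilon>) X)"
      by (simp add: E_def)
    have "roux_scheme B s ** X = mat_smult (roux_P n c i s) X"
      using roux_scheme_eigenvectors[OF assms(4,2) \<alpha> roux_mu_quadratic[OF assms(1)] X_def]
      by (cases s) (simp_all add: roux_P_def i del: roux_scheme.simps)
    then show ?thesis
      unfolding E by (simp add: mat_smult_mult_right mult_ac)
  qed
  have "bij_betw E (characters \<times> UNIV) (primitive_idempotents (roux_scheme B))"
    and "first_eigenmatrix (roux_scheme B) (characters \<times> UNIV) E (roux_P n c)"
    using primitive_idempotents_from_eigenmatrices[OF commutative_scheme_roux_scheme[OF assms(3) N] _ _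
        PQ E_def eig] by (simp_all add: finite_characters UNIV_sign)
  with PQ show ?thesis
    by (intro exI[of _ E] exI[of _ "roux_P n c"] exI[of _ "roux_Q n c"])
      (simp add: roux_P_def roux_Q_def)
qed

end
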